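(* Let $0<\varepsilon\le\frac1{24}$, let $n,k$ be positive integers with $n\ge k/\varepsilon$, and let $\mathcal F\subset\binom{[n]}{k}$ be a nonempty intersecting family with $|\mathcal F|\ge 48\binom{n-3}{k-3}$. Then $\varrho(\mathcal F)>\frac23-\varepsilon$.
   Context: A family $\mathcal F$ is intersecting if $F\cap F'\neq\emptyset$ for all $F,F'\in\mathcal F$. For $i\in[n]$, $\mathcal F(i)=\{F\setminus\{i\}: i\in F\in\mathcal F\}$, and $\varrho(\mathcal F)=\max_{i\in[n]}|\mathcal F(i)|/|\mathcal F|$. *)

theory Defs
  imports Main "HOL-Library.Disjoint_Sets" Complex_Main
begin

definition intersecting :: "'a set set \<Rightarrow> bool" where
  "intersecting F \<longleftrightarrow> (\<forall>A\<in>F. \<forall>B\<in>F. A \<inter> B \<noteq> {})"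

definition link :: "'a set set \<Rightarrow> 'a \<Rightarrow> 'a set set" where
  "link F i = {A - {i} | A. A \<in> F \<and> i \<in> A}"

definition rho :: "nat \<Rightarrow> nat set set \<Rightarrow> real" where
  "rho n F = Max ((\<lambda>i. real (card (link F i)) / real (card F)) ` {1..n})"

definition binom3 :: "nat \<Rightarrow> nat \<Rightarrow> nat" where
  "binom3 n k = (if k \<ge> 3 then (n - 3) choose (k - 3) else 0)"

end

theory Submission
  imports Defs
begin

text \<open>
  Assume that every element is avoided by at least a third (plus \<open>\<epsilon>\<close>) of \<open>F\<close>, and let \<open>a\<close> be the
  number of k-sets through three given points. Among shifted cross-intersecting families, a family
  of k-sets through two given points that has more than a small multiple of \<open>a\<close> members forces its
  partner to have size \<open>O(a)\<close>; since shifting preserves sizes, this also holds without shiftedness.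
  Consequently, three elements whose pairs all have degree above \<open>3.6 a\<close> are impossible: all
  but \<open>O(\<epsilon> a)\<close> of the sets would contain two of the three, and some degree would exceed
  \<open>2/3 - \<epsilon>\<close>. Such a triple is found by shifting \<open>F\<close> for as long as all elements stay widely
  avoided. A pair \<open>i, j\<close> whose shift is forbidden satisfies \<open>|F(no i, no j)| < (1/3 + \<epsilon>) |F|\<close>, and
  two disjoint such pairs yield a pair of large degree. A pair \<open>x, y\<close> of large degree is kept fixed
  by shifting only the other elements; the third element is then either the first one of a
  completely shifted family or a member of a forbidden pair.
\<close>

section \<open>Uniform families, shifting and its invariants\<close>

definition ksets :: "'a set \<Rightarrow> nat \<Rightarrow> 'a set set" where
  "ksets V k = {A. A \<subseteq> V \<and> card A = k}"

text \<open>The intersection is required inside \<open>X\<close> because only elements of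
  \<open>X\<close> get shifted; prescribed elements outside \<open>X\<close> stay fixed.\<close>

definition cross_on :: "'a set \<Rightarrow> 'a set set \<Rightarrow> 'a set set \<Rightarrow> bool" where
  "cross_on X P Q \<longleftrightarrow> (\<forall>A\<in>P. \<forall>B\<in>Q. A \<inter> B \<inter> X \<noteq> {})"

text \<open>The usual compression replacing \<open>j\<close> by \<open>i\<close>. A set whose
  replacement is already in \<open>F\<close> stays put, which keeps the map injective on
  \<open>F\<close>.\<close>

definition shift_set :: "'a \<Rightarrow> 'a \<Rightarrow> 'a set set \<Rightarrow> 'a set \<Rightarrow> 'a set" where
  "shift_set i j F A =
     (if j \<in> A \<and> i \<notin> A \<and> insert i (A - {j}) \<notin> F then insert i (A - {j}) else A)"

definition shift :: "'a \<Rightarrow> 'a \<Rightarrow> 'a set set \<Rightarrow> 'a set set" where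
  "shift i j F = shift_set i j F ` F"

definition shifted :: "('a \<Rightarrow> nat) \<Rightarrow> 'a set \<Rightarrow> 'a set set \<Rightarrow> bool" where
  "shifted w X F \<longleftrightarrow>
     (\<forall>A\<in>F. \<forall>i\<in>X. \<forall>j\<in>X. w i < w j \<longrightarrow> j \<in> A \<longrightarrow> i \<notin> A \<longrightarrow> insert i (A - {j}) \<in> F)"

text \<open>A potential for termination: each effective shift towards smaller \<open>w\<close>
  lowers it.\<close>

definition wt :: "('a \<Rightarrow> nat) \<Rightarrow> 'a set \<Rightarrow> 'a set set \<Rightarrow> nat" where
  "wt w X F = (\<Sum>A\<in>F. \<Sum>x\<in>A \<inter> X. w x)"

text \<open>If \<open>w\<close> numbers \<open>X\<close> bijectively from 0, these are the first
  \<open>i\<close> elements of \<open>X\<close>, cut off at the end of \<open>X\<close>.\<close>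

definition seg :: "('a \<Rightarrow> nat) \<Rightarrow> 'a set \<Rightarrow> nat \<Rightarrow> 'a set" where
  "seg w X i = {x \<in> X. w x < i}"

definition cnt :: "'a set set \<Rightarrow> ('a set \<Rightarrow> bool) \<Rightarrow> real" where
  "cnt F \<phi> = real (card {A \<in> F. \<phi> A})"

lemma finite_ksets: "finite V \<Longrightarrow> finite (ksets V k)"
  unfolding ksets_def by (rule finite_subset[of _ "Pow V"]) auto

text \<open>The image reveals whether a set has moved: moved sets land outside \<open>F\<close>,
  unmoved ones inside. Moved sets are recovered by swapping back.\<close>

lemma inj_on_shift_set: "inj_on (shift_set i j F) F"
proof (rule inj_onI)
  fix A B assume "A \<in> F" and "B \<in> F" and e: "shift_set i j F A = shift_set i j F B"
  have undo_swap: "C = insert j (insert i (C - {j}) - {i})" if "j \<in> C" "i \<notin> C" for C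
    using that by auto
  show "A = B"
  proof (cases "j \<in> A \<and> i \<notin> A \<and> insert i (A - {j}) \<notin> F")
    case True
    then have B: "j \<in> B \<and> i \<notin> B \<and> insert i (B - {j}) \<notin> F"
      using e \<open>B \<in> F\<close> unfolding shift_set_def by (auto split: if_splits)
    with True e have "insert i (A - {j}) = insert i (B - {j})" unfolding shift_set_def by simp
    then show ?thesis using undo_swap True B by metis
  next
    case False
    then have "\<not> (j \<in> B \<and> i \<notin> B \<and> insert i (B - {j}) \<notin> F)"
      using e \<open>A \<in> F\<close> unfolding shift_set_def by (auto split: if_splits)
    with False e show ?thesis unfolding shift_set_def by (simp split: if_splits)
  qed
qed

lemma card_shift: "card (shift i j F) = card F"
  unfolding shift_def by (simp add: card_image inj_on_shift_set)

lemma shift_ksets: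
  assumes "F \<subseteq> ksets V k" "finite V" "i \<in> V"
  shows "shift i j F \<subseteq> ksets V k"
proof
  fix B assume "B \<in> shift i j F"
  then obtain A where A: "A \<in> F" "B = shift_set i j F A" unfolding shift_def by auto
  then have "A \<subseteq> V" "card A = k" "finite A"
    using assms by (auto simp: ksets_def intro: finite_subset)
  then show "B \<in> ksets V k"
    using A assms(3) unfolding shift_set_def ksets_def by (auto simp: card_insert_if dest: card_Suc_Diff1)
qed

lemma shift_superset:
  assumes "\<forall>A\<in>F. T \<subseteq> A" "j \<notin> T"
  shows "\<forall>A\<in>shift i j F. T \<subseteq> A"
  using assms unfolding shift_def shift_set_def by auto

lemma cnt_shift:
  assumes "\<And>A. A \<in> F \<Longrightarrow> j \<in> A \<Longrightarrow> i \<notin> A \<Longrightarrow> \<phi> (insert i (A - {j})) = \<phi> A"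
  shows "cnt (shift i j F) \<phi> = cnt F \<phi>"
proof -
  have "\<phi> (shift_set i j F A) = \<phi> A" if "A \<in> F" for A
    using assms[OF that] unfolding shift_set_def by auto
  then have "{B \<in> shift i j F. \<phi> B} = shift_set i j F ` {A \<in> F. \<phi> A}"
    unfolding shift_def by auto
  moreover have "inj_on (shift_set i j F) {A \<in> F. \<phi> A}"
    by (rule inj_on_subset[OF inj_on_shift_set]) auto
  ultimately show ?thesis unfolding cnt_def by (simp add: card_image)
qed

text \<open>Sets without \<open>j\<close> never move, so they survive the shift.\<close>

lemma cnt_shift_ge:
  assumes "finite F" "\<And>A. \<phi> A \<Longrightarrow> j \<notin> A" "\<And>A. \<phi> A \<Longrightarrow> \<psi> A"
  shows "cnt F \<phi> \<le> cnt (shift i j F) \<psi>"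
proof -
  have "A \<in> shift i j F" if "A \<in> F" "j \<notin> A" for A
    using that unfolding shift_def shift_set_def by force
  then have "{A \<in> F. \<phi> A} \<subseteq> {A \<in> shift i j F. \<psi> A}" using assms by auto
  moreover have "finite (shift i j F)" unfolding shift_def using assms(1) by simp
  ultimately show ?thesis unfolding cnt_def by (simp add: card_mono)
qed

text \<open>Two moved sets share \<open>i\<close>, and two unmoved sets meet as before. The mixed
  case is \<open>one_moved\<close>: if moving \<open>A\<close> destroyed the intersection with an
  unmoved \<open>B\<close>, then \<open>A\<close> and \<open>B\<close> met only in \<open>j\<close>;
  \<open>B\<close> stayed because its own replacement is in the family, and that replacement would
  miss \<open>A\<close>.\<close>

lemma cross_on_shift:
  assumes c: "cross_on X P Q" and ij: "i \<in> X" "j \<in> X"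
  shows "cross_on X (shift i j P) (shift i j Q)"
  unfolding cross_on_def
proof (intro ballI)
  have one_moved: "insert i (A - {j}) \<inter> B \<inter> X \<noteq> {}"
    if c: "cross_on X P Q" and A: "A \<in> P" "j \<in> A" "i \<notin> A"
      and B: "B \<in> Q" "\<not> (j \<in> B \<and> i \<notin> B \<and> insert i (B - {j}) \<notin> Q)" for A B P Q
  proof
    assume e: "insert i (A - {j}) \<inter> B \<inter> X = {}"
    then have iB: "i \<notin> B" using ij by auto
    have AB: "A \<inter> B \<inter> X \<subseteq> {j}" using e by auto
    moreover have "A \<inter> B \<inter> X \<noteq> {}" using c A(1) B(1) unfolding cross_on_def by blast
    ultimately have "j \<in> B" by blast
    then have "insert i (B - {j}) \<in> Q" using B(2) iB by auto
    then have "A \<inter> insert i (B - {j}) \<inter> X \<noteq> {}" using c A(1) unfolding cross_on_def by blast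
    then show False using AB A(3) by auto
  qed
  have c': "cross_on X Q P" using c unfolding cross_on_def by (metis inf_commute)
  fix A' B' assume "A' \<in> shift i j P" "B' \<in> shift i j Q"
  then obtain A B where A: "A \<in> P" "A' = shift_set i j P A" and B: "B \<in> Q" "B' = shift_set i j Q B"
    unfolding shift_def by auto
  let ?m = "\<lambda>F A. j \<in> A \<and> i \<notin> A \<and> insert i (A - {j}) \<notin> F"
  consider "?m P A" "?m Q B" | "?m P A" "\<not> ?m Q B" | "\<not> ?m P A" "?m Q B"
    | "\<not> ?m P A" "\<not> ?m Q B" by blast
  then show "A' \<inter> B' \<inter> X \<noteq> {}"
  proof cases
    case 1 then show ?thesis using A B ij unfolding shift_set_def by auto
  next
    case 2
    then have "A' = insert i (A - {j})" "B' = B" using A B unfolding shift_set_def by (simp_all only: if_True if_False simp_thms)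
    then show ?thesis using one_moved[OF c, of A B] A B 2 by simp
  next
    case 3
    then have "B' = insert i (B - {j})" "A' = A" using A B unfolding shift_set_def by (simp_all only: if_True if_False simp_thms)
    then show ?thesis using one_moved[OF c', of B A] A B 3 by (simp add: Int_commute)
  next
    case 4
    then have "A' = A" "B' = B" using A B unfolding shift_set_def by (simp_all only: if_True if_False simp_thms)
    then show ?thesis using c A B unfolding cross_on_def by blast
  qed
qed

lemma sum_shift_set:
  assumes "finite A" "i \<in> X" "j \<in> X" "w i < w j"
  shows "(\<Sum>x\<in>shift_set i j F A \<inter> X. w x) \<le> (\<Sum>x\<in>A \<inter> X. w x)"
    and "shift_set i j F A \<noteq> A \<Longrightarrow> (\<Sum>x\<in>shift_set i j F A \<inter> X. w x) < (\<Sum>x\<in>A \<inter> X. w x :: nat)"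
proof -
  have *: "(\<Sum>x\<in>insert i (A - {j}) \<inter> X. w x) < (\<Sum>x\<in>A \<inter> X. w x)" if "j \<in> A" "i \<notin> A"
  proof -
    have e: "insert i (A - {j}) \<inter> X = insert i ((A \<inter> X) - {j})" using assms by auto
    have "(\<Sum>x\<in>insert i (A - {j}) \<inter> X. w x) = w i + (\<Sum>x\<in>(A \<inter> X) - {j}. w x)"
      unfolding e using that assms by (subst sum.insert) auto
    moreover have "(\<Sum>x\<in>A \<inter> X. w x) = w j + (\<Sum>x\<in>(A \<inter> X) - {j}. w x)"
      using that assms by (intro sum.remove) auto
    ultimately show ?thesis using assms(4) by simp
  qed
  show "(\<Sum>x\<in>shift_set i j F A \<inter> X. w x) \<le> (\<Sum>x\<in>A \<inter> X. w x)"
    using * unfolding shift_set_def by (auto intro: less_imp_le)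
  show "shift_set i j F A \<noteq> A \<Longrightarrow> (\<Sum>x\<in>shift_set i j F A \<inter> X. w x) < (\<Sum>x\<in>A \<inter> X. w x :: nat)"
    using * unfolding shift_set_def by (auto split: if_splits)
qed

lemma wt_shift:
  assumes "finite F" "\<And>A. A \<in> F \<Longrightarrow> finite A" "i \<in> X" "j \<in> X" "w i < w j"
  shows "wt w X (shift i j F) \<le> wt w X F"
    and "A \<in> F \<Longrightarrow> j \<in> A \<Longrightarrow> i \<notin> A \<Longrightarrow> insert i (A - {j}) \<notin> F \<Longrightarrow> wt w X (shift i j F) < wt w X F"
proof -
  have e: "wt w X (shift i j F) = (\<Sum>A\<in>F. \<Sum>x\<in>shift_set i j F A \<inter> X. w x)"
    unfolding wt_def shift_def by (simp add: sum.reindex[OF inj_on_shift_set] o_def)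
  show "wt w X (shift i j F) \<le> wt w X F"
    unfolding e unfolding wt_def using assms by (intro sum_mono sum_shift_set) auto
  assume A: "A \<in> F" "j \<in> A" "i \<notin> A" "insert i (A - {j}) \<notin> F"
  then have "shift_set i j F A \<noteq> A" unfolding shift_set_def by auto
  then have "(\<Sum>x\<in>shift_set i j F A \<inter> X. w x) < (\<Sum>x\<in>A \<inter> X. w x)"
    using sum_shift_set(2)[OF _ assms(3-5)] assms(2) A by blast
  then show "wt w X (shift i j F) < wt w X F"
    unfolding e unfolding wt_def using assms A(1)
    by (intro sum_strict_mono_ex1 ballI bexI[of _ A] sum_shift_set) auto
qed

section \<open>Shifted cross-intersecting pairs read as walks\<close>

text \<open>Both families are shifted simultaneously until the total potential \<open>wt\<close> can
  no longer drop. \<open>T\<close> and \<open>T'\<close> lie outside \<open>X\<close>, so no shift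
  removes their elements.\<close>

lemma exists_shifted_cross:
  assumes "finite V" "X \<subseteq> V" "P \<subseteq> ksets V k" "Q \<subseteq> ksets V k" "cross_on X P Q"
    "\<forall>A\<in>P. T \<subseteq> A" "\<forall>A\<in>Q. T' \<subseteq> A" "T \<inter> X = {}" "T' \<inter> X = {}"
  obtains P' Q' where "P' \<subseteq> ksets V k" "Q' \<subseteq> ksets V k" "cross_on X P' Q'"
    "\<forall>A\<in>P'. T \<subseteq> A" "\<forall>A\<in>Q'. T' \<subseteq> A" "card P' = card P" "card Q' = card Q"
    "shifted w X P'" "shifted w X Q'"
proof -
  have "\<exists>P' Q'. P' \<subseteq> ksets V k \<and> Q' \<subseteq> ksets V k \<and> cross_on X P' Q' \<and>
    (\<forall>A\<in>P'. T \<subseteq> A) \<and> (\<forall>A\<in>Q'. T' \<subseteq> A) \<and> card P' = card P \<and> card Q' = card Q \<and>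
    shifted w X P' \<and> shifted w X Q'"
    using assms(3-7)
  proof (induction "wt w X P + wt w X Q" arbitrary: P Q rule: less_induct)
    case less
    show ?case
    proof (cases "shifted w X P \<and> shifted w X Q")
      case True
      then show ?thesis using less.prems by blast
    next
      case False
      then obtain i j where ij: "i \<in> X" "j \<in> X" "w i < w j"
        and nf: "(\<exists>A\<in>P. j \<in> A \<and> i \<notin> A \<and> insert i (A - {j}) \<notin> P) \<or>
          (\<exists>A\<in>Q. j \<in> A \<and> i \<notin> A \<and> insert i (A - {j}) \<notin> Q)"
        unfolding shifted_def by blast
      have fin: "finite P" "finite Q" "\<And>A. A \<in> P \<Longrightarrow> finite A" "\<And>A. A \<in> Q \<Longrightarrow> finite A"
        using less.prems(1,2) finite_ksets[OF assms(1)] finite_subset[OF _ assms(1)]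
        by (auto simp: ksets_def intro: finite_subset)
      have le: "wt w X (shift i j P) \<le> wt w X P" "wt w X (shift i j Q) \<le> wt w X Q"
        using wt_shift(1)[where w=w, OF _ _ ij] fin by auto
      have "wt w X (shift i j P) < wt w X P \<or> wt w X (shift i j Q) < wt w X Q"
        using nf wt_shift(2)[where w=w, OF fin(1,3) ij] wt_shift(2)[where w=w, OF fin(2,4) ij] by blast
      then have lt: "wt w X (shift i j P) + wt w X (shift i j Q) < wt w X P + wt w X Q"
        using le by linarith
      have "i \<in> V" "j \<notin> T" "j \<notin> T'" using ij assms by auto
      have "\<exists>P' Q'. P' \<subseteq> ksets V k \<and> Q' \<subseteq> ksets V k \<and> cross_on X P' Q' \<and>
        (\<forall>A\<in>P'. T \<subseteq> A) \<and> (\<forall>A\<in>Q'. T' \<subseteq> A) \<and> card P' = card (shift i j P) \<and>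
        card Q' = card (shift i j Q) \<and> shifted w X P' \<and> shifted w X Q'"
        using less.prems ij \<open>i \<in> V\<close> \<open>j \<notin> T\<close> \<open>j \<notin> T'\<close>
        by (intro less.hyps[OF lt] shift_ksets cross_on_shift shift_superset assms(1))
      then show ?thesis by (simp only: card_shift)
    qed
  qed
  then show ?thesis using that by blast
qed

lemma card_seg:
  assumes "bij_betw w X {..<card X}"
  shows "card (seg w X i) \<le> i" and "i \<le> card X \<Longrightarrow> card (seg w X i) = i"
proof -
  have "w ` seg w X i = {..<min i (card X)}"
  proof -
    have "w ` seg w X i = w ` X \<inter> {..<i}" unfolding seg_def by auto
    then show ?thesis using assms unfolding bij_betw_def by auto
  qed
  moreover have "inj_on w (seg w X i)"
    using assms unfolding bij_betw_def seg_def by (auto intro: inj_on_subset)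
  ultimately have "card (seg w X i) = card {..<min i (card X)}"
    by (metis card_image)
  then show "card (seg w X i) \<le> i" "i \<le> card X \<Longrightarrow> card (seg w X i) = i" by auto
qed

text \<open>If no initial segment is overfull, the segment ending at the first common element of
  \<open>A\<close> and \<open>B\<close> has a position free of both. Shifting \<open>A\<close> there
  removes a common element inside \<open>X\<close>; repetition would produce a pair that does not
  meet in \<open>X\<close>.\<close>

lemma shifted_cross_walk:
  assumes fin: "finite X" and bij: "bij_betw w X {..<card X}" and sh: "shifted w X P"
    and cr: "cross_on X P Q" and B: "B \<in> Q" and A: "A \<in> P"
  shows "\<exists>i. i < card (A \<inter> seg w X i) + card (B \<inter> seg w X i)"
  using A
proof (induction "card (A \<inter> B \<inter> X)" arbitrary: A rule: less_induct)
  case less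
  let ?S = "seg w X"
  have finS: "finite (?S i)" for i using fin unfolding seg_def by auto
  show ?case
  proof (rule ccontr)
    assume "\<nexists>i. i < card (A \<inter> ?S i) + card (B \<inter> ?S i)"
    then have walk: "card (A \<inter> ?S i) + card (B \<inter> ?S i) \<le> i" for i by (meson not_less)
    have "A \<inter> B \<inter> X \<noteq> {}" using cr B less.prems unfolding cross_on_def by auto
    then obtain t where t: "t \<in> A \<inter> B \<inter> X" and tmin: "\<And>x. x \<in> A \<inter> B \<inter> X \<Longrightarrow> w t \<le> w x"
      using ex_has_least_nat[of "\<lambda>x. x \<in> A \<inter> B \<inter> X" _ w] by blast
    \<comment> \<open>The shortest initial segment that includes \<open>t\<close>: there the two
      traces overlap, so their union has fewer than \<open>?j\<close> elements.\<close>
    let ?j = "Suc (w t)"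
    have "w t < card X" using bij t unfolding bij_betw_def by auto
    then have cj: "card (?S ?j) = ?j" using card_seg(2)[OF bij] by auto
    have "t \<in> A \<inter> ?S ?j \<inter> (B \<inter> ?S ?j)" using t unfolding seg_def by auto
    then have "card (A \<inter> ?S ?j \<inter> (B \<inter> ?S ?j)) > 0" using finS by (auto simp: card_gt_0_iff)
    then have "card ((A \<inter> ?S ?j) \<union> (B \<inter> ?S ?j)) < ?j"
      using card_Un_Int[of "A \<inter> ?S ?j" "B \<inter> ?S ?j"] finS walk[of ?j] by auto
    then have "\<not> ?S ?j \<subseteq> (A \<inter> ?S ?j) \<union> (B \<inter> ?S ?j)"
      using cj card_mono[of "(A \<inter> ?S ?j) \<union> (B \<inter> ?S ?j)" "?S ?j"] finS by auto
    then obtain s where s: "s \<in> ?S ?j" "s \<notin> A" "s \<notin> B" by auto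
    then have sX: "s \<in> X" and st: "s \<noteq> t" "w s \<le> w t" using t unfolding seg_def by auto
    have ws: "w s < w t"
      using st sX t bij_betw_imp_inj_on[OF bij] inj_on_eq_iff[of w X s t] by auto
    \<comment> \<open>\<open>t\<close> is the first common element, so before \<open>t\<close> the new set is still disjoint from \<open>B\<close> and
      after \<open>t\<close> its walk is unchanged: the pair stays a counterexample with fewer common elements.\<close>
    define A' where "A' = insert s (A - {t})"
    have A': "A' \<in> P" using sh less.prems sX t ws s unfolding shifted_def A'_def by auto
    have "A' \<inter> B \<inter> X = A \<inter> B \<inter> X - {t}" using s unfolding A'_def by auto
    then have "card (A' \<inter> B \<inter> X) < card (A \<inter> B \<inter> X)"
      using t fin by (metis card_Diff1_less finite_Int)
    from less.hyps[OF this A'] obtain i where i: "i < card (A' \<inter> ?S i) + card (B \<inter> ?S i)" by auto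
    show False
    proof (cases "w t < i")
      case True
      then have "A' \<inter> ?S i = insert s (A \<inter> ?S i - {t})" "t \<in> A \<inter> ?S i"
        using ws sX t unfolding A'_def seg_def by auto
      then have "card (A' \<inter> ?S i) = card (A \<inter> ?S i)"
        using s finS by (simp add: card_insert_if card_Suc_Diff1 del: card_Diff_insert)
      then show False using i walk[of i] by auto
    next
      case False
      have "A' \<inter> ?S i \<inter> (B \<inter> ?S i) = {}"
        using tmin s False unfolding A'_def seg_def by force
      then have "card (A' \<inter> ?S i) + card (B \<inter> ?S i) = card ((A' \<inter> ?S i) \<union> (B \<inter> ?S i))"
        using finS by (intro card_Un_disjoint[symmetric]) auto
      also have "\<dots> \<le> card (?S i)" using finS by (intro card_mono) auto
      also have "\<dots> \<le> i" by (rule card_seg[OF bij])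
      finally show False using i by simp
    qed
  qed
qed

section \<open>Counting k-sets and members of a family\<close>

lemma card_ksets_superset:
  assumes "finite V" "T \<subseteq> V"
  shows "card {A \<in> ksets V k. T \<subseteq> A} =
    (if card T \<le> k then (card V - card T) choose (k - card T) else 0)"
proof (cases "card T \<le> k")
  case True
  have fT: "finite T" using assms finite_subset by auto
  have "bij_betw (\<lambda>B. B \<union> T) {B. B \<subseteq> V - T \<and> card B = k - card T} {A \<in> ksets V k. T \<subseteq> A}"
  proof (rule bij_betwI[where g="\<lambda>A. A - T"])
    show "(\<lambda>B. B \<union> T) \<in> {B. B \<subseteq> V - T \<and> card B = k - card T} \<rightarrow> {A \<in> ksets V k. T \<subseteq> A}"
    proof
      fix B assume B: "B \<in> {B. B \<subseteq> V - T \<and> card B = k - card T}"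
      then have "finite B" using assms finite_subset by blast
      then have "card (B \<union> T) = card B + card T" using B fT by (intro card_Un_disjoint) auto
      then show "B \<union> T \<in> {A \<in> ksets V k. T \<subseteq> A}" using B True assms unfolding ksets_def by auto
    qed
    show "(\<lambda>A. A - T) \<in> {A \<in> ksets V k. T \<subseteq> A} \<rightarrow> {B. B \<subseteq> V - T \<and> card B = k - card T}"
      using fT unfolding ksets_def by (auto simp: card_Diff_subset)
  qed (auto simp: ksets_def)
  then have "card {A \<in> ksets V k. T \<subseteq> A} = card {B. B \<subseteq> V - T \<and> card B = k - card T}"
    by (rule bij_betw_same_card[symmetric])
  also have "\<dots> = (card V - card T) choose (k - card T)"
    using assms fT by (simp add: n_subsets card_Diff_subset)
  finally show ?thesis using True by simp
next
  case False
  have "\<not> T \<subseteq> A" if "A \<in> ksets V k" for A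
    using that False assms card_mono[of A T] finite_subset[of A V] unfolding ksets_def by auto
  then have "{A \<in> ksets V k. T \<subseteq> A} = {}" by auto
  then show ?thesis using False by (simp only: card.empty if_False)
qed

lemma cnt_split:
  assumes "finite F"
  shows "cnt F \<phi> = cnt F (\<lambda>A. \<phi> A \<and> \<psi> A) + cnt F (\<lambda>A. \<phi> A \<and> \<not> \<psi> A)"
proof -
  have "{A \<in> F. \<phi> A} = {A \<in> F. \<phi> A \<and> \<psi> A} \<union> {A \<in> F. \<phi> A \<and> \<not> \<psi> A}" by auto
  then have "card {A \<in> F. \<phi> A} = card {A \<in> F. \<phi> A \<and> \<psi> A} + card {A \<in> F. \<phi> A \<and> \<not> \<psi> A}"
    using assms by (simp only:) (rule card_Un_disjoint, auto)
  then show ?thesis unfolding cnt_def by simp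
qed

lemma cnt_mono:
  assumes "finite F" "\<And>A. A \<in> F \<Longrightarrow> \<phi> A \<Longrightarrow> \<psi> A"
  shows "cnt F \<phi> \<le> cnt F \<psi>"
proof -
  have "{A \<in> F. \<phi> A} \<subseteq> {A \<in> F. \<psi> A}" using assms(2) by blast
  then show ?thesis unfolding cnt_def using assms(1) by (simp add: card_mono)
qed

lemma cnt_le_add:
  assumes "finite F" "\<And>A. A \<in> F \<Longrightarrow> \<phi> A \<Longrightarrow> \<psi> A \<or> \<chi> A"
  shows "cnt F \<phi> \<le> cnt F \<psi> + cnt F \<chi>"
proof -
  have "cnt F \<phi> = cnt F (\<lambda>A. \<phi> A \<and> \<psi> A) + cnt F (\<lambda>A. \<phi> A \<and> \<not> \<psi> A)"
    using assms(1) by (rule cnt_split)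
  also have "\<dots> \<le> cnt F \<psi> + cnt F \<chi>"
    using assms by (intro add_mono cnt_mono) auto
  finally show ?thesis .
qed

lemma cnt_le_add4:
  assumes "finite F" "\<And>A. A \<in> F \<Longrightarrow> \<phi> A \<Longrightarrow> \<psi> A \<or> \<chi> A \<or> \<psi>' A \<or> \<chi>' A"
  shows "cnt F \<phi> \<le> cnt F \<psi> + cnt F \<chi> + cnt F \<psi>' + cnt F \<chi>'"
proof -
  have "cnt F \<phi> \<le> cnt F (\<lambda>A. \<psi> A \<or> \<chi> A) + cnt F (\<lambda>A. \<psi>' A \<or> \<chi>' A)"
    using assms by (intro cnt_le_add) auto
  also have "\<dots> \<le> (cnt F \<psi> + cnt F \<chi>) + (cnt F \<psi>' + cnt F \<chi>')"
    using assms by (intro add_mono cnt_le_add) auto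
  finally show ?thesis by simp
qed

lemma cnt_add_le:
  assumes "finite F" "\<And>A. A \<in> F \<Longrightarrow> \<psi> A \<Longrightarrow> \<phi> A" "\<And>A. A \<in> F \<Longrightarrow> \<chi> A \<Longrightarrow> \<phi> A \<and> \<not> \<psi> A"
  shows "cnt F \<psi> + cnt F \<chi> \<le> cnt F \<phi>"
proof -
  have "cnt F \<phi> = cnt F (\<lambda>A. \<phi> A \<and> \<psi> A) + cnt F (\<lambda>A. \<phi> A \<and> \<not> \<psi> A)"
    using assms(1) by (rule cnt_split)
  also have "\<dots> \<ge> cnt F \<psi> + cnt F \<chi>"
    using assms by (intro add_mono cnt_mono) auto
  finally show ?thesis .
qed

text \<open>A set avoiding \<open>m\<close> of three elements avoids \<open>m choose 2\<close> pairs, and \<open>m \<le> 1 + (m choose 2)\<close>.\<close>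
lemma cnt_avoid_three_le:
  assumes "finite F"
  shows "cnt F (\<lambda>A. x \<notin> A) + cnt F (\<lambda>A. y \<notin> A) + cnt F (\<lambda>A. z \<notin> A)
    \<le> real (card F) + cnt F (\<lambda>A. x \<notin> A \<and> y \<notin> A) + cnt F (\<lambda>A. x \<notin> A \<and> z \<notin> A)
      + cnt F (\<lambda>A. y \<notin> A \<and> z \<notin> A)"
proof -
  have e: "cnt F \<phi> = (\<Sum>A\<in>F. of_bool (\<phi> A))" for \<phi>
    unfolding cnt_def using assms by (simp add: sum.If_cases of_bool_def Int_def)
  have "real (card F) = (\<Sum>A\<in>F. 1)" by simp
  then show ?thesis
    unfolding e sum.distrib[symmetric] by (simp only: sum.distrib[symmetric]) (intro sum_mono, auto)
qed

section \<open>Numerical bounds for walk sums\<close>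

text \<open>
  Read a set along an enumeration as a 0-1 walk. The j-th term bounds the share of sets having
  \<open>r + j\<close> of the first \<open>b + 2 j\<close> elements, each additional element costing a factor \<open>k/n \<le> 1/24\<close>.
\<close>
definition walk_sum :: "nat \<Rightarrow> nat \<Rightarrow> nat \<Rightarrow> real" where
  "walk_sum b r K = (\<Sum>j\<le>K. real ((b + 2 * j) choose (r + j)) / 24 ^ j)"

text \<open>The first four terms are kept exactly. Later binomials are at most
  \<open>2 ^ (b + 2 * j)\<close>, so these terms are dominated by a geometric series of ratio 4/24 =
  1/6.\<close>

lemma walk_sum_le:
  assumes "3 \<le> K"
  shows "walk_sum b r K \<le> real (b choose r) + real ((b + 2) choose (r + 1)) / 24
    + real ((b + 4) choose (r + 2)) / 576 + real ((b + 6) choose (r + 3)) / 13824 + 2 ^ b / 1080"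
    (is "_ \<le> ?h")
proof -
  \<comment> \<open>Strengthened for the induction: the added summand is the whole geometric tail
    beyond \<open>K\<close>. At \<open>K = 3\<close> it equals \<open>2 ^ b / 1080\<close>.\<close>
  have "walk_sum b r K + 2 ^ b / (5 * 6 ^ K) \<le> ?h"
    using assms
  proof (induction K rule: dec_induct)
    case base
    show ?case unfolding walk_sum_def by (simp add: numeral_eq_Suc)
  next
    case (step K)
    have "real ((b + 2 * Suc K) choose (r + Suc K)) \<le> 2 ^ (b + 2 * Suc K)"
      using binomial_le_pow2[of "b + 2 * Suc K" "r + Suc K"] by (metis of_nat_le_iff of_nat_numeral of_nat_power)
    then have "real ((b + 2 * Suc K) choose (r + Suc K)) / 24 ^ Suc K \<le> 2 ^ (b + 2 * Suc K) / 24 ^ Suc K"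
      by (intro divide_right_mono) auto
    also have "\<dots> = 2 ^ b * (4 / 24) ^ Suc K"
      by (simp only: power_add power_mult power_divide) simp
    also have "\<dots> = 2 ^ b / 6 ^ Suc K" by (simp add: power_divide power_one_over)
    finally have "walk_sum b r (Suc K) \<le> walk_sum b r K + 2 ^ b / 6 ^ Suc K"
      unfolding walk_sum_def by simp
    moreover have "2 ^ b / 6 ^ Suc K + 2 ^ b / (5 * 6 ^ Suc K) = (2 ^ b / (5 * 6 ^ K) :: real)"
      by (simp add: field_simps)
    ultimately show ?case using step.IH by linarith
  qed
  moreover have "0 \<le> (2 ^ b / (5 * 6 ^ K) :: real)" by simp
  ultimately show ?thesis by linarith
qed

text \<open>The parameters \<open>s, 1\<close> and \<open>s + 1, s + 1\<close> are the two sides of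
  the dichotomy below for \<open>s\<close> = 1, 2, 3; \<open>4, 3\<close> serves completely shifted
  families.\<close>

lemma walk_sum_numeric:
  assumes "3 \<le> K"
  shows "walk_sum 1 1 K \<le> 1.2" "walk_sum 2 1 K \<le> 2.4" "walk_sum 3 1 K \<le> 3.6"
    "walk_sum 2 2 K \<le> 5/4" "walk_sum 3 3 K \<le> 1.3" "walk_sum 4 4 K \<le> 1.5" "walk_sum 4 3 K \<le> 4.8"
  using walk_sum_le[OF assms, of 1 1] walk_sum_le[OF assms, of 2 1] walk_sum_le[OF assms, of 3 1]
    walk_sum_le[OF assms, of 2 2] walk_sum_le[OF assms, of 3 3] walk_sum_le[OF assms, of 4 4]
    walk_sum_le[OF assms, of 4 3]
  by (simp_all add: binomial_fact' fact_numeral)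

section \<open>Size dichotomies for cross-intersecting families of k-sets\<close>

locale uniform_sets =
  fixes V :: "'a set" and k :: nat and \<epsilon> :: real
  assumes finV: "finite V" and k3: "3 \<le> k" and kV: "real k \<le> \<epsilon> * real (card V)"
    and eps0: "0 < \<epsilon>" and eps24: "\<epsilon> \<le> 1/24"
begin

text \<open>
  The number of k-sets containing a given m-set; the case split avoids the junk value of
  \<open>k - m\<close> for \<open>m > k\<close>.
\<close>
definition sups :: "nat \<Rightarrow> real" where
  "sups m = (if m \<le> k then real ((card V - m) choose (k - m)) else 0)"

abbreviation a :: real where "a \<equiv> sups 3"

lemma k_le: "24 * k \<le> card V"
proof -
  have "real k \<le> (1/24) * real (card V)"
    using kV eps24 by (meson mult_right_mono of_nat_0_le_iff order_trans)
  then show ?thesis by linarith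
qed

lemma a_ge1: "1 \<le> a"
  using k3 k_le by (auto simp: sups_def Suc_le_eq zero_less_binomial_iff)

text \<open>Consecutive binomials have ratio (k - m)/(n - m) with n = \<open>card V\<close>, and
  this is at most \<open>\<epsilon>\<close> because k is at most \<open>\<epsilon>\<close> n and
  \<open>\<epsilon>\<close> is below 1.\<close>

lemma sups_Suc: "sups (Suc m) \<le> \<epsilon> * sups m"
proof (cases "Suc m \<le> k")
  case True
  let ?N = "card V - m" and ?M = "k - m"
  have N: "?N = Suc (card V - Suc m)" "?M = Suc (k - Suc m)" using True k_le by auto
  have "?N * ((card V - Suc m) choose (k - Suc m)) = ?M * (?N choose ?M)"
    using N Suc_times_binomial_eq by (metis mult.commute)
  then have e: "real ?N * sups (Suc m) = real ?M * sups m"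
    using True unfolding sups_def by (simp only: if_True Suc_leD flip: of_nat_mult)
  have "real ?M \<le> \<epsilon> * real ?N"
  proof -
    have "\<epsilon> * real m \<le> 1 * real m" using eps24 by (intro mult_right_mono) auto
    then show ?thesis using True k_le kV by (simp add: of_nat_diff algebra_simps)
  qed
  then have "real ?N * sups (Suc m) \<le> \<epsilon> * real ?N * sups m"
    unfolding e by (intro mult_right_mono) (auto simp: sups_def)
  then have "real ?N * sups (Suc m) \<le> real ?N * (\<epsilon> * sups m)" by (simp add: ac_simps)
  moreover have "0 < real ?N" using N by simp
  ultimately show ?thesis by (simp only: mult_le_cancel_left_pos)
next
  case False
  then show ?thesis using eps0 unfolding sups_def by auto
qed

lemma sups_nonneg: "0 \<le> sups m" unfolding sups_def by auto

lemma sups_add: "sups (m + j) \<le> sups m / 24 ^ j"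
proof (induction j)
  case (Suc j)
  have "sups (m + Suc j) \<le> \<epsilon> * sups (m + j)" using sups_Suc by simp
  also have "\<dots> \<le> (1/24) * sups (m + j)" using eps24 sups_nonneg by (intro mult_right_mono) auto
  also have "\<dots> \<le> (1/24) * (sups m / 24 ^ j)" using Suc by (intro mult_left_mono) auto
  finally show ?case by simp
qed simp

lemma card_superset_le:
  assumes "P \<subseteq> ksets V k" "T \<subseteq> V" "\<forall>A\<in>P. T \<subseteq> A"
  shows "real (card P) \<le> sups (card T)"
proof -
  have "P \<subseteq> {A \<in> ksets V k. T \<subseteq> A}" using assms by auto
  then have "card P \<le> card {A \<in> ksets V k. T \<subseteq> A}"
    by (intro card_mono) (auto simp: finite_ksets finV)
  then show ?thesis
    unfolding card_ksets_superset[OF finV assms(2)] sups_def by (auto split: if_splits)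
qed

text \<open>Union bound over the r-subsets of \<open>S\<close> that a member may contain besides
  \<open>T\<close>.\<close>

lemma card_ge_inter_le:
  assumes P: "P \<subseteq> ksets V k" "\<forall>A\<in>P. T \<subseteq> A" and T: "T \<subseteq> V" and S: "S \<subseteq> V" "T \<inter> S = {}"
  shows "real (card {A \<in> P. r \<le> card (A \<inter> S)}) \<le> real (card S choose r) * sups (card T + r)"
proof -
  have fS: "finite S" "finite T" using S T finV by (auto intro: finite_subset)
  let ?R = "{R. R \<subseteq> S \<and> card R = r}"
  have sub: "{A \<in> P. r \<le> card (A \<inter> S)} \<subseteq> (\<Union>R\<in>?R. {A \<in> P. T \<union> R \<subseteq> A})"
  proof
    fix A assume A: "A \<in> {A \<in> P. r \<le> card (A \<inter> S)}"
    then obtain R where "R \<subseteq> A \<inter> S" "card R = r" using obtain_subset_with_card_n by blast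
    then show "A \<in> (\<Union>R\<in>?R. {A \<in> P. T \<union> R \<subseteq> A})" using A P by auto
  qed
  have fP: "finite P" using P(1) finite_ksets[OF finV] by (rule finite_subset)
  have "card {A \<in> P. r \<le> card (A \<inter> S)} \<le> card (\<Union>R\<in>?R. {A \<in> P. T \<union> R \<subseteq> A})"
    using fP fS by (intro card_mono[OF _ sub]) auto
  also have "\<dots> \<le> (\<Sum>R\<in>?R. card {A \<in> P. T \<union> R \<subseteq> A})"
    using fS by (intro card_UN_le) auto
  finally have "real (card {A \<in> P. r \<le> card (A \<inter> S)}) \<le> (\<Sum>R\<in>?R. real (card {A \<in> P. T \<union> R \<subseteq> A}))"
    unfolding of_nat_sum[symmetric] of_nat_le_iff .
  also have "\<dots> \<le> (\<Sum>R\<in>?R. sups (card T + r))"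
  proof (rule sum_mono)
    fix R assume R: "R \<in> ?R"
    then have "card (T \<union> R) = card T + r"
      using S fS by (subst card_Un_disjoint) (auto intro: finite_subset)
    moreover have "real (card {A \<in> P. T \<union> R \<subseteq> A}) \<le> sups (card (T \<union> R))"
      using R P T S by (intro card_superset_le) auto
    ultimately show "real (card {A \<in> P. T \<union> R \<subseteq> A}) \<le> sups (card T + r)" by simp
  qed
  also have "\<dots> = real (card S choose r) * sups (card T + r)"
    using fS by (simp add: n_subsets)
  finally show ?thesis .
qed

text \<open>Union bound over \<open>j\<close>. Reaching \<open>r + j\<close> elements prescribes
  \<open>j\<close> further elements, and each costs a factor 1/24 by
  \<open>sups_add\<close>.\<close>

lemma card_walk_le:
  assumes P: "P \<subseteq> ksets V k" "\<forall>A\<in>P. T \<subseteq> A" and T: "T \<subseteq> V"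
    and S: "\<And>j. S j \<subseteq> V" "\<And>j. T \<inter> S j = {}" "\<And>j. card (S j) \<le> b + 2 * j"
    and walk: "\<And>A. A \<in> P \<Longrightarrow> \<exists>j. r + j \<le> card (A \<inter> S j)"
  shows "real (card P) \<le> walk_sum b r k * sups (card T + r)"
proof -
  have fP: "finite P" using P(1) finite_ksets[OF finV] by (rule finite_subset)
  \<comment> \<open>The union may stop at \<open>k\<close>, since a member has only \<open>k\<close>
    elements.\<close>
  have "P \<subseteq> (\<Union>j\<in>{..k}. {A \<in> P. r + j \<le> card (A \<inter> S j)})"
  proof
    fix A assume A: "A \<in> P"
    then obtain j where j: "r + j \<le> card (A \<inter> S j)" using walk by auto
    have "card A = k" "finite A" using A P finV unfolding ksets_def by (auto intro: finite_subset)
    then have "card (A \<inter> S j) \<le> k" by (metis card_mono inf_le1)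
    then show "A \<in> (\<Union>j\<in>{..k}. {A \<in> P. r + j \<le> card (A \<inter> S j)})" using j A by auto
  qed
  then have "card P \<le> card (\<Union>j\<in>{..k}. {A \<in> P. r + j \<le> card (A \<inter> S j)})"
    using fP by (intro card_mono) auto
  also have "\<dots> \<le> (\<Sum>j\<in>{..k}. card {A \<in> P. r + j \<le> card (A \<inter> S j)})"
    by (intro card_UN_le) auto
  finally have "real (card P) \<le> (\<Sum>j\<le>k. real (card {A \<in> P. r + j \<le> card (A \<inter> S j)}))"
    unfolding of_nat_sum[symmetric] of_nat_le_iff .
  also have "\<dots> \<le> (\<Sum>j\<le>k. real ((b + 2 * j) choose (r + j)) * (sups (card T + r) / 24 ^ j))"
  proof (rule sum_mono)
    fix j
    have "real (card {A \<in> P. r + j \<le> card (A \<inter> S j)})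
        \<le> real (card (S j) choose (r + j)) * sups (card T + (r + j))"
      using assms by (intro card_ge_inter_le) auto
    also have "\<dots> \<le> real ((b + 2 * j) choose (r + j)) * sups (card T + (r + j))"
      using S(3) sups_nonneg by (intro mult_right_mono) (auto intro: binomial_right_mono)
    also have "\<dots> \<le> real ((b + 2 * j) choose (r + j)) * (sups (card T + r) / 24 ^ j)"
      using sups_add[of "card T + r" j] by (intro mult_left_mono) (auto simp: add.assoc)
    finally show "real (card {A \<in> P. r + j \<le> card (A \<inter> S j)})
      \<le> real ((b + 2 * j) choose (r + j)) * (sups (card T + r) / 24 ^ j)" .
  qed
  also have "\<dots> = walk_sum b r k * sups (card T + r)"
    unfolding walk_sum_def sum_distrib_right by simp
  finally show ?thesis .
qed

text \<open>One sparse member of \<open>P\<close> makes all of \<open>Q\<close> dense: where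
  \<open>A\<close> is thin, only \<open>B\<close> can make the segment overfull. So each
  \<open>B\<close> has at least \<open>s + 1 + j\<close> of the first \<open>s + 1 + 2 * j\<close>
  elements for some \<open>j\<close>.\<close>

lemma shifted_cross_bound:
  assumes X: "X \<subseteq> V" and bij: "bij_betw w X {..<card X}"
    and PQ: "P \<subseteq> ksets V k" "Q \<subseteq> ksets V k" "shifted w X P" "cross_on X P Q"
    and T': "\<forall>B\<in>Q. T' \<subseteq> B" "T' \<subseteq> V" "T' \<inter> X = {}"
    and A: "A \<in> P" "\<And>j. card (A \<inter> seg w X (s + 2 * j)) \<le> j"
  shows "real (card Q) \<le> walk_sum (s + 1) (s + 1) k * sups (card T' + (s + 1))"
proof (rule card_walk_le[where S="\<lambda>j. seg w X (s + 1 + 2 * j)"])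
  have finX: "finite X" using X finV by (rule finite_subset)
  have fs: "finite (seg w X i)" for i using finX unfolding seg_def by auto
  show "\<exists>j. s + 1 + j \<le> card (B \<inter> seg w X (s + 1 + 2 * j))" if B: "B \<in> Q" for B
  proof -
    obtain i where i: "i < card (A \<inter> seg w X i) + card (B \<inter> seg w X i)"
      using shifted_cross_walk[OF finX bij PQ(3,4) B A(1)] by auto
    have mono: "card (C \<inter> seg w X m) \<le> card (C \<inter> seg w X m')" if "m \<le> m'" for C m m'
      using that fs by (intro card_mono) (auto simp: seg_def)
    \<comment> \<open>Sparsity at \<open>j = 0\<close> says that \<open>A\<close> misses the first
      \<open>s\<close> elements; up to there \<open>B\<close> alone cannot overfill a
      segment.\<close>
    have "s < i"
    proof (rule ccontr)
      assume "\<not> s < i"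
      then have "card (A \<inter> seg w X i) \<le> 0" using mono[of i s A] A(2)[of 0] by simp
      moreover have "card (B \<inter> seg w X i) \<le> card (seg w X i)" using fs by (intro card_mono) auto
      ultimately show False using i card_seg(1)[OF bij, of i] by linarith
    qed
    \<comment> \<open>Pairs up the times \<open>s + 1 + 2 * j\<close> and
      \<open>s + 2 + 2 * j\<close>: at both, \<open>A\<close> has at most \<open>j + 1\<close>
      elements. From the later time, stepping back by one costs \<open>B\<close> at most one
      element.\<close>
    define j where "j = (i - s - 1) div 2"
    have ij: "i = s + 1 + 2 * j \<or> i = Suc (s + 1 + 2 * j)"
      using \<open>s < i\<close> unfolding j_def by presburger
    then have "i \<le> s + 2 * (j + 1)" by auto
    then have Aj: "card (A \<inter> seg w X i) \<le> j + 1"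
      using mono[of i "s + 2 * (j + 1)" A] A(2)[of "j + 1"] by linarith
    have step: "card (B \<inter> seg w X (Suc m)) \<le> Suc (card (B \<inter> seg w X m))" for m
    proof (cases "\<exists>x\<in>X. w x = m")
      case True
      then obtain x where x: "x \<in> X" "w x = m" by auto
      have "seg w X (Suc m) \<subseteq> insert x (seg w X m)"
        using x bij unfolding seg_def bij_betw_def inj_on_def by (auto simp: less_Suc_eq)
      then have "card (B \<inter> seg w X (Suc m)) \<le> card (insert x (B \<inter> seg w X m))"
        using fs by (intro card_mono) auto
      also have "\<dots> \<le> Suc (card (B \<inter> seg w X m))" using fs by (simp add: card_insert_if)
      finally show ?thesis .
    next
      case False
      then have "seg w X (Suc m) = seg w X m" unfolding seg_def by (auto simp: less_Suc_eq)
      then show ?thesis by simp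
    qed
    have "s + 1 + j \<le> card (B \<inter> seg w X (s + 1 + 2 * j))"
      using ij
    proof
      assume "i = s + 1 + 2 * j"
      then show ?thesis using i Aj by simp
    next
      assume "i = Suc (s + 1 + 2 * j)"
      then show ?thesis using i Aj step[of "s + 1 + 2 * j"] by simp
    qed
    then show ?thesis by blast
  qed
qed (use X PQ T' card_seg(1)[OF bij] in \<open>auto simp: seg_def\<close>)

lemma sparse_member_or_small:
  assumes X: "X \<subseteq> V" and bij: "bij_betw w X {..<card X}"
    and P: "P \<subseteq> ksets V k" "\<forall>A\<in>P. T \<subseteq> A" "T \<subseteq> V" "T \<inter> X = {}"
    and small: "walk_sum s 1 k * sups (card T + 1) < real (card P)"
  shows "\<exists>A\<in>P. \<forall>j. card (A \<inter> seg w X (s + 2 * j)) \<le> j"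
proof (rule ccontr)
  assume "\<not> ?thesis"
  then have "\<And>A. A \<in> P \<Longrightarrow> \<exists>j. 1 + j \<le> card (A \<inter> seg w X (s + 2 * j))"
    by (metis not_less_eq_eq plus_1_eq_Suc)
  then have "real (card P) \<le> walk_sum s 1 k * sups (card T + 1)"
    using X P card_seg(1)[OF bij] by (intro card_walk_le[where S="\<lambda>j. seg w X (s + 2 * j)"]) (auto simp: seg_def)
  then show False using small by simp
qed

text \<open>Only sizes are asserted, so both families may be replaced by shifted ones. Either
  \<open>P\<close> has a sparse member, which bounds \<open>Q\<close>, or all its walks are dense,
  which bounds \<open>P\<close>. Raising \<open>s\<close> weakens the bound on \<open>P\<close> but
  prescribes one more element in \<open>Q\<close>.\<close>

lemma cross_dichotomy:
  assumes PQ: "P \<subseteq> ksets V k" "Q \<subseteq> ksets V k" "cross_on X P Q" and X: "X \<subseteq> V"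
    and T: "\<forall>A\<in>P. T \<subseteq> A" "T \<subseteq> V" "T \<inter> X = {}" "card T = 2"
    and T': "\<forall>B\<in>Q. T' \<subseteq> B" "T' \<subseteq> V" "T' \<inter> X = {}"
  shows "real (card P) \<le> walk_sum s 1 k * a \<or>
    real (card Q) \<le> walk_sum (s + 1) (s + 1) k * sups (card T' + (s + 1))"
proof -
  have finX: "finite X" using X finV by (rule finite_subset)
  obtain w where w: "bij_betw w X {..<card X}"
    using ex_bij_betw_finite_nat[OF finX] by (auto simp: atLeast0LessThan)
  obtain P' Q' where P': "P' \<subseteq> ksets V k" "Q' \<subseteq> ksets V k" "cross_on X P' Q'"
    "\<forall>A\<in>P'. T \<subseteq> A" "\<forall>A\<in>Q'. T' \<subseteq> A" "card P' = card P" "card Q' = card Q"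
    "shifted w X P'" "shifted w X Q'"
    using exists_shifted_cross[OF finV X PQ T(1) T'(1) T(3) T'(3)] by blast
  show ?thesis
  proof (cases "walk_sum s 1 k * sups (card T + 1) < real (card P')")
    case True
    then obtain A where "A \<in> P'" "\<And>j. card (A \<inter> seg w X (s + 2 * j)) \<le> j"
      using sparse_member_or_small[OF X w P'(1,4) T(2,3)] by blast
    then show ?thesis
      using shifted_cross_bound[OF X w P'(1,2,8,3,5) T'(2,3)] P'(7) by metis
  next
    case False
    then show ?thesis using P'(6) T(4) by (auto simp: numeral_3_eq_3)
  qed
qed

text \<open>\<open>D\<close> collects the elements on which the two conditions prescribe disjoint
  traces; members satisfying them must therefore meet outside \<open>D\<close>.\<close>

lemma cnt_dichotomy:
  assumes G: "G \<subseteq> ksets V k" "cross_on V G G"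
    and T: "\<And>A. A \<in> G \<Longrightarrow> \<phi> A \<Longrightarrow> T \<subseteq> A" "T \<subseteq> D" "T \<subseteq> V" "card T = 2"
    and T': "\<And>A. A \<in> G \<Longrightarrow> \<psi> A \<Longrightarrow> T' \<subseteq> A" "T' \<subseteq> D" "T' \<subseteq> V"
    and disj: "\<And>A B. \<phi> A \<Longrightarrow> \<psi> B \<Longrightarrow> A \<inter> B \<inter> D = {}"
  shows "cnt G \<phi> \<le> walk_sum s 1 k * a \<or>
    cnt G \<psi> \<le> walk_sum (s + 1) (s + 1) k * sups (card T' + (s + 1))"
proof -
  have "cross_on (V - D) {A \<in> G. \<phi> A} {A \<in> G. \<psi> A}"
    unfolding cross_on_def
  proof (intro ballI)
    fix A B assume A: "A \<in> {A \<in> G. \<phi> A}" and B: "B \<in> {A \<in> G. \<psi> A}"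
    then have "A \<inter> B \<inter> D = {}" "A \<inter> B \<inter> V \<noteq> {}" using disj G(2) unfolding cross_on_def by auto
    then show "A \<inter> B \<inter> (V - D) \<noteq> {}" by blast
  qed
  then show ?thesis
    unfolding cnt_def using G(1) T T'
    by (intro cross_dichotomy[where T=T and X="V - D"]) auto
qed

lemma a_mult_mono: "c \<le> d \<Longrightarrow> c * a \<le> d * a"
  using a_ge1 by (intro mult_right_mono) auto

text \<open>The case \<open>s = 1\<close> with one prescribed element on the second side: 1 + 2 = 3
  elements, hence a multiple of \<open>a\<close>.\<close>

lemma cnt_dichotomy1:
  assumes "G \<subseteq> ksets V k" "cross_on V G G"
    "\<And>A. A \<in> G \<Longrightarrow> \<phi> A \<Longrightarrow> x \<in> A \<and> y \<in> A" "{x, y} \<subseteq> V" "x \<noteq> y" "{x, y} \<subseteq> D"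
    "\<And>A. A \<in> G \<Longrightarrow> \<psi> A \<Longrightarrow> z \<in> A" "z \<in> V" "z \<in> D"
    "\<And>A B. \<phi> A \<Longrightarrow> \<psi> B \<Longrightarrow> A \<inter> B \<inter> D = {}"
  shows "cnt G \<phi> \<le> 1.2 * a \<or> cnt G \<psi> \<le> 5/4 * a"
proof -
  have "cnt G \<phi> \<le> walk_sum 1 1 k * a \<or> cnt G \<psi> \<le> walk_sum (1 + 1) (1 + 1) k * sups (card {z} + (1 + 1))"
    using assms by (intro cnt_dichotomy[where T="{x, y}" and D=D]) auto
  moreover have "walk_sum 1 1 k * a \<le> 1.2 * a" "walk_sum 2 2 k * a \<le> 5/4 * a"
    using walk_sum_numeric[OF k3] by (intro a_mult_mono; simp)+
  ultimately show ?thesis by (auto simp: numeral_eq_Suc)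
qed

lemma cnt_dichotomy2:
  assumes "G \<subseteq> ksets V k" "cross_on V G G" "x \<in> V" "y \<in> V" "x \<noteq> y"
  shows "cnt G (\<lambda>A. x \<in> A \<and> y \<in> A) \<le> 2.4 * a \<or> cnt G (\<lambda>A. x \<notin> A \<and> y \<notin> A) \<le> 1.3 * a"
proof -
  have "cnt G (\<lambda>A. x \<in> A \<and> y \<in> A) \<le> walk_sum 2 1 k * a \<or>
    cnt G (\<lambda>A. x \<notin> A \<and> y \<notin> A) \<le> walk_sum (2 + 1) (2 + 1) k * sups (card ({} :: 'a set) + (2 + 1))"
    using assms by (intro cnt_dichotomy[where T="{x, y}" and D="{x, y}"]) auto
  moreover have "walk_sum 2 1 k * a \<le> 2.4 * a" "walk_sum 3 3 k * a \<le> 1.3 * a"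
    using walk_sum_numeric[OF k3] by (intro a_mult_mono; simp)+
  ultimately show ?thesis by auto
qed

text \<open>With \<open>s = 3\<close> and nothing prescribed on the second side, four elements are
  forced there; \<open>sups 4\<close> gains the factor \<open>\<epsilon>\<close> over
  \<open>a\<close>.\<close>

lemma cnt_dichotomy3:
  assumes "G \<subseteq> ksets V k" "cross_on V G G" "x \<in> V" "y \<in> V" "x \<noteq> y"
  shows "cnt G (\<lambda>A. x \<in> A \<and> y \<in> A) \<le> 3.6 * a \<or> cnt G (\<lambda>A. x \<notin> A \<and> y \<notin> A) \<le> 1.5 * \<epsilon> * a"
proof -
  have "cnt G (\<lambda>A. x \<in> A \<and> y \<in> A) \<le> walk_sum 3 1 k * a \<or>
    cnt G (\<lambda>A. x \<notin> A \<and> y \<notin> A) \<le> walk_sum (3 + 1) (3 + 1) k * sups (card ({} :: 'a set) + (3 + 1))"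
    using assms by (intro cnt_dichotomy[where T="{x, y}" and D="{x, y}"]) auto
  moreover have "walk_sum 3 1 k * a \<le> 3.6 * a"
    using walk_sum_numeric[OF k3] by (intro a_mult_mono; simp)
  moreover have "walk_sum 4 4 k * sups 4 \<le> 1.5 * (\<epsilon> * a)"
    using walk_sum_numeric[OF k3] sups_Suc[of 3] sups_nonneg by (intro mult_mono) auto
  ultimately show ?thesis by auto
qed

text \<open>Prescribing the single element \<open>u\<close> is enough here because \<open>P\<close>
  is already shifted and \<open>p\<close> comes first. If no \<open>p\<close>-avoiding member of
  \<open>P\<close> is sparse, each of them has \<open>2 + i\<close> of the \<open>2 + 2 * i\<close>
  elements following \<open>p\<close>, for some \<open>i\<close>.\<close>

lemma first_element_dichotomy:
  assumes X: "X \<subseteq> V" and bij: "bij_betw w X {..<card X}" and p: "p \<in> X" "w p = 0"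
    and PQ: "P \<subseteq> ksets V k" "Q \<subseteq> ksets V k" "shifted w X P" "cross_on X P Q"
    and u: "\<forall>A\<in>P. u \<in> A" "u \<in> V - X" and v: "\<forall>B\<in>Q. v \<in> B" "v \<in> V - X"
  shows "real (card {A \<in> P. p \<notin> A}) \<le> 5/4 * a \<or> real (card Q) \<le> 5/4 * a"
proof (cases "\<exists>A\<in>P. p \<notin> A \<and> (\<forall>j. card (A \<inter> seg w X (1 + 2 * j)) \<le> j)")
  case True
  then obtain A where A: "A \<in> P" "\<And>j. card (A \<inter> seg w X (1 + 2 * j)) \<le> j" by auto
  have "real (card Q) \<le> walk_sum (1 + 1) (1 + 1) k * sups (card {v} + (1 + 1))"
    using v by (intro shifted_cross_bound[OF X bij PQ _ _ _ A]) auto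
  also have "\<dots> \<le> 5/4 * a"
    using a_mult_mono[OF walk_sum_numeric(4)[OF k3]] by (simp add: eval_nat_numeral)
  finally show ?thesis by simp
next
  case False
  have finX: "finite X" using X finV by (rule finite_subset)
  have seg1: "seg w X 1 = {p}"
    using p bij unfolding seg_def bij_betw_def inj_on_def by auto
  have "real (card {A \<in> P. p \<notin> A}) \<le> walk_sum 2 2 k * sups (card {u} + 2)"
  proof (rule card_walk_le[where S="\<lambda>j. seg w X (3 + 2 * j) - {p}"])
    show "\<exists>j. 2 + j \<le> card (A \<inter> (seg w X (3 + 2 * j) - {p}))" if A: "A \<in> {A \<in> P. p \<notin> A}" for A
    proof -
      obtain j where j: "j < card (A \<inter> seg w X (1 + 2 * j))" using False A by (auto simp: not_le)
      \<comment> \<open>At \<open>j = 0\<close> the segment is just \<open>{p}\<close>, which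
        \<open>A\<close> misses.\<close>
      have "j \<noteq> 0" using j A seg1 by (intro notI) auto
      then obtain i where i: "j = Suc i" using not0_implies_Suc by auto
      have "A \<inter> (seg w X (3 + 2 * i) - {p}) = A \<inter> seg w X (1 + 2 * j)"
        using A i by (auto simp: eval_nat_numeral)
      then show ?thesis using j i by (intro exI[of _ i]) auto
    qed
    show "card (seg w X (3 + 2 * j) - {p}) \<le> 2 + 2 * j" for j
    proof -
      have "p \<in> seg w X (3 + 2 * j)" "finite (seg w X (3 + 2 * j))"
        using p finX unfolding seg_def by auto
      then show ?thesis using card_seg(1)[OF bij, of "3 + 2 * j"] by simp
    qed
  qed (use X PQ u in \<open>auto simp: seg_def\<close>)
  also have "\<dots> \<le> 5/4 * a"
    using a_mult_mono[OF walk_sum_numeric(4)[OF k3]] by (simp add: eval_nat_numeral)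
  finally show ?thesis by simp
qed

section \<open>Counterexamples and shifts that preserve them\<close>

text \<open>A counterexample with k at least 3: the bound on \<open>rho\<close> is expressed by the
  number of sets avoiding each element. The condition \<open>cross_on V F F\<close> is intersection
  inside the ground set.\<close>

definition dispersed :: "'a set set \<Rightarrow> bool" where
  "dispersed F \<longleftrightarrow> F \<subseteq> ksets V k \<and> cross_on V F F \<and> 48 * a \<le> real (card F) \<and>
     (\<forall>x\<in>V. (1/3 + \<epsilon>) * real (card F) \<le> cnt F (\<lambda>A. x \<notin> A))"

lemma dispersedD:
  assumes "dispersed F"
  shows "F \<subseteq> ksets V k" "cross_on V F F" "finite F"
    and "x \<in> V \<Longrightarrow> (1/3 + \<epsilon>) * real (card F) \<le> cnt F (\<lambda>A. x \<notin> A)"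
    and "16 * a \<le> (1/3 + \<epsilon>) * real (card F)" and "48 * a \<le> real (card F)"
proof -
  show F: "F \<subseteq> ksets V k" "cross_on V F F" "48 * a \<le> real (card F)"
    "x \<in> V \<Longrightarrow> (1/3 + \<epsilon>) * real (card F) \<le> cnt F (\<lambda>A. x \<notin> A)"
    using assms unfolding dispersed_def by auto
  show "finite F" using F(1) finite_ksets[OF finV] by (rule finite_subset)
  have "(1/3) * real (card F) \<le> (1/3 + \<epsilon>) * real (card F)"
    using eps0 by (intro mult_right_mono) auto
  then show "16 * a \<le> (1/3 + \<epsilon>) * real (card F)" using F(3) by linarith
qed

text \<open>A shift from \<open>j\<close> to \<open>i\<close> can reduce only the number of sets
  avoiding \<open>i\<close>, and sets avoiding both elements stay. So the shift is harmless unless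
  the pair is bad, that is, too few sets avoid both. The invariance of \<open>\<phi>\<close> carries
  degrees of elements outside \<open>X\<close> over to \<open>G\<close>.\<close>

lemma exists_shifted_or_bad_pair:
  assumes "dispersed F" and X: "X \<subseteq> V"
  obtains G where "dispersed G" "card G = card F"
    "\<And>\<phi>. (\<And>A B. A - X = B - X \<Longrightarrow> \<phi> A = \<phi> B) \<Longrightarrow> cnt G \<phi> = cnt F \<phi>"
    "shifted w X G \<or>
     (\<exists>i\<in>X. \<exists>j\<in>X. i \<noteq> j \<and> cnt G (\<lambda>A. i \<notin> A \<and> j \<notin> A) < (1/3 + \<epsilon>) * real (card G))"
proof -
  have "\<exists>G. dispersed G \<and> card G = card F \<and>
    (\<forall>\<phi>. (\<forall>A B. A - X = B - X \<longrightarrow> \<phi> A = \<phi> B) \<longrightarrow> cnt G \<phi> = cnt F \<phi>) \<and>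
    (shifted w X G \<or>
     (\<exists>i\<in>X. \<exists>j\<in>X. i \<noteq> j \<and> cnt G (\<lambda>A. i \<notin> A \<and> j \<notin> A) < (1/3 + \<epsilon>) * real (card G)))"
    using assms(1)
  proof (induction "wt w X F" arbitrary: F rule: less_induct)
    case less
    note F = dispersedD[OF less.prems]
    show ?case
    proof (cases "shifted w X F \<or>
     (\<exists>i\<in>X. \<exists>j\<in>X. i \<noteq> j \<and> cnt F (\<lambda>A. i \<notin> A \<and> j \<notin> A) < (1/3 + \<epsilon>) * real (card F))")
      case True
      then show ?thesis using less.prems by blast
    next
      case False
      then obtain i j A where ij: "i \<in> X" "j \<in> X" "w i < w j"
        and A: "A \<in> F" "j \<in> A" "i \<notin> A" "insert i (A - {j}) \<notin> F"
        unfolding shifted_def by blast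
      have "i \<noteq> j" using ij by auto
      then have good: "(1/3 + \<epsilon>) * real (card F) \<le> cnt F (\<lambda>A. i \<notin> A \<and> j \<notin> A)"
        using False ij by (meson not_le)
      have iV: "i \<in> V" "j \<in> V" using ij X by auto
      have "finite A" if "A \<in> F" for A
        using that F(1) finV unfolding ksets_def by (auto intro: finite_subset)
      then have lt: "wt w X (shift i j F) < wt w X F"
        using wt_shift(2)[where w=w, OF F(3) _ ij A] by blast
      have avoid: "(1/3 + \<epsilon>) * real (card F) \<le> cnt (shift i j F) (\<lambda>A. x \<notin> A)" if x: "x \<in> V" for x
      proof -
        consider "x = i" | "x = j" | "x \<noteq> i" "x \<noteq> j" by blast
        then show ?thesis
        proof cases
          case 1
          then show ?thesis
            using good cnt_shift_ge[OF F(3), where j=j and i=i and \<phi>="\<lambda>A. i \<notin> A \<and> j \<notin> A" and \<psi>="\<lambda>A. x \<notin> A"] by auto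
        next
          case 2
          then show ?thesis
            using F(4)[OF x] cnt_shift_ge[OF F(3), where j=j and i=i and \<phi>="\<lambda>A. j \<notin> A" and \<psi>="\<lambda>A. x \<notin> A"] by auto
        next
          case 3
          then have "cnt (shift i j F) (\<lambda>A. x \<notin> A) = cnt F (\<lambda>A. x \<notin> A)" by (intro cnt_shift) auto
          then show ?thesis using F(4)[OF x] by simp
        qed
      qed
      have disp: "dispersed (shift i j F)"
        unfolding dispersed_def card_shift
        using shift_ksets[OF F(1) finV iV(1)] cross_on_shift[OF F(2) iV] F(6) avoid by blast
      have same: "cnt (shift i j F) \<phi> = cnt F \<phi>" if "\<forall>A B. A - X = B - X \<longrightarrow> \<phi> A = \<phi> B" for \<phi>
      proof (rule cnt_shift)
        fix A
        have "insert i (A - {j}) - X = A - X" using ij by auto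
        then show "\<phi> (insert i (A - {j})) = \<phi> A" using that by blast
      qed
      from less.hyps[OF lt disp] obtain G where G: "dispersed G" "card G = card F"
        "\<forall>\<phi>. (\<forall>A B. A - X = B - X \<longrightarrow> \<phi> A = \<phi> B) \<longrightarrow> cnt G \<phi> = cnt (shift i j F) \<phi>"
        "shifted w X G \<or>
         (\<exists>i\<in>X. \<exists>j\<in>X. i \<noteq> j \<and> cnt G (\<lambda>A. i \<notin> A \<and> j \<notin> A) < (1/3 + \<epsilon>) * real (card G))"
        unfolding card_shift by (elim exE conjE)
      have "\<forall>\<phi>. (\<forall>A B. A - X = B - X \<longrightarrow> \<phi> A = \<phi> B) \<longrightarrow> cnt G \<phi> = cnt F \<phi>"
      proof (intro allI impI)
        fix \<phi> :: "'a set \<Rightarrow> bool"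
        assume \<phi>: "\<forall>A B. A - X = B - X \<longrightarrow> \<phi> A = \<phi> B"
        show "cnt G \<phi> = cnt F \<phi>" using mp[OF spec[OF G(3)] \<phi>] same[OF \<phi>] by (rule trans)
      qed
      then show ?thesis using G(1,2,4) by (intro exI[of _ G] conjI)
    qed
  qed
  then obtain G where G: "dispersed G" "card G = card F"
    "\<forall>\<phi>. (\<forall>A B. A - X = B - X \<longrightarrow> \<phi> A = \<phi> B) \<longrightarrow> cnt G \<phi> = cnt F \<phi>"
    "shifted w X G \<or>
     (\<exists>i\<in>X. \<exists>j\<in>X. i \<noteq> j \<and> cnt G (\<lambda>A. i \<notin> A \<and> j \<notin> A) < (1/3 + \<epsilon>) * real (card G))"
    by (elim exE conjE)
  show ?thesis
  proof (rule that[OF G(1,2) _ G(4)])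
    fix \<phi> :: "'a set \<Rightarrow> bool"
    assume "\<And>A B. A - X = B - X \<Longrightarrow> \<phi> A = \<phi> B"
    then show "cnt G \<phi> = cnt F \<phi>" by (intro mp[OF spec[OF G(3)]] allI impI)
  qed
qed

section \<open>Heavy triples and heavy pairs are impossible\<close>

text \<open>By \<open>cnt_dichotomy3\<close>, at most \<open>1.5 * \<epsilon> * a\<close> sets miss
  any one of the pairs. Adding the three avoidance counts then gives
  \<open>3 * \<epsilon> * card F\<close> at most \<open>4.5 * \<epsilon> * a\<close>, against
  \<open>card F\<close> being at least \<open>48 * a\<close>.\<close>

lemma no_three_heavy_pairs:
  assumes F: "dispersed F" and xyz: "x \<in> V" "y \<in> V" "z \<in> V" "x \<noteq> y" "x \<noteq> z" "y \<noteq> z"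
    and h: "3.6 * a < cnt F (\<lambda>A. x \<in> A \<and> y \<in> A)" "3.6 * a < cnt F (\<lambda>A. x \<in> A \<and> z \<in> A)"
      "3.6 * a < cnt F (\<lambda>A. y \<in> A \<and> z \<in> A)"
  shows False
proof -
  note D = dispersedD[OF F]
  have "cnt F (\<lambda>A. x \<notin> A \<and> y \<notin> A) \<le> 1.5 * \<epsilon> * a" "cnt F (\<lambda>A. x \<notin> A \<and> z \<notin> A) \<le> 1.5 * \<epsilon> * a"
    "cnt F (\<lambda>A. y \<notin> A \<and> z \<notin> A) \<le> 1.5 * \<epsilon> * a"
    using cnt_dichotomy3[OF D(1,2), of x y] cnt_dichotomy3[OF D(1,2), of x z]
      cnt_dichotomy3[OF D(1,2), of y z] h xyz by auto
  moreover note cnt_avoid_three_le[OF D(3), of x y z]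
  moreover note D(4)[OF xyz(1)] D(4)[OF xyz(2)] D(4)[OF xyz(3)]
  ultimately have "3 * ((1/3 + \<epsilon>) * real (card F)) \<le> real (card F) + 4.5 * (\<epsilon> * a)" by linarith
  then have "3 * (\<epsilon> * real (card F)) \<le> 4.5 * (\<epsilon> * a)" by (simp add: algebra_simps)
  moreover have "\<epsilon> * (48 * a) \<le> \<epsilon> * real (card F)" using D(6) eps0 by (intro mult_left_mono) auto
  moreover have "0 < \<epsilon> * a" using eps0 a_ge1 by simp
  ultimately show False by linarith
qed

text \<open>Each element is avoided by at least \<open>16 * a\<close> sets. Under
  \<open>few\<close>, nearly all sets avoiding one of the three elements contain the other two, so
  all three pairs are heavy.\<close>

lemma no_third_element:
  assumes F: "dispersed F" and xyz: "x \<in> V" "y \<in> V" "z \<in> V" "x \<noteq> y" "x \<noteq> z" "y \<noteq> z"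
    and few: "cnt F (\<lambda>A. x \<notin> A \<and> y \<notin> A) \<le> 1.3 * a"
      "cnt F (\<lambda>A. x \<in> A \<and> y \<notin> A \<and> z \<notin> A) \<le> 3 * a"
      "cnt F (\<lambda>A. x \<notin> A \<and> y \<in> A \<and> z \<notin> A) \<le> 3 * a"
  shows False
proof -
  note D = dispersedD[OF F]
  have "cnt F (\<lambda>A. x \<notin> A) \<le> cnt F (\<lambda>A. y \<in> A \<and> z \<in> A) + cnt F (\<lambda>A. x \<notin> A \<and> y \<notin> A)
      + cnt F (\<lambda>A. x \<notin> A \<and> y \<in> A \<and> z \<notin> A) + cnt F (\<lambda>A. False)"
    by (rule cnt_le_add4[OF D(3)]) blast
  moreover have "cnt F (\<lambda>A. y \<notin> A) \<le> cnt F (\<lambda>A. x \<in> A \<and> z \<in> A) + cnt F (\<lambda>A. x \<notin> A \<and> y \<notin> A)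
      + cnt F (\<lambda>A. x \<in> A \<and> y \<notin> A \<and> z \<notin> A) + cnt F (\<lambda>A. False)"
    by (rule cnt_le_add4[OF D(3)]) blast
  moreover have "cnt F (\<lambda>A. z \<notin> A) \<le> cnt F (\<lambda>A. x \<in> A \<and> y \<in> A) + cnt F (\<lambda>A. x \<notin> A \<and> y \<notin> A)
      + cnt F (\<lambda>A. x \<in> A \<and> y \<notin> A \<and> z \<notin> A) + cnt F (\<lambda>A. x \<notin> A \<and> y \<in> A \<and> z \<notin> A)"
    by (rule cnt_le_add4[OF D(3)]) blast
  moreover have "cnt F (\<lambda>A. False) = 0" unfolding cnt_def by simp
  moreover note D(4)[OF xyz(1)] D(4)[OF xyz(2)] D(4)[OF xyz(3)] D(5) few a_ge1
  ultimately show False by (intro no_three_heavy_pairs[OF F xyz]) linarith+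
qed

text \<open>Sets with exactly one of \<open>x\<close>, \<open>y\<close> are classified by their
  trace on \<open>{i, j}\<close>. The dichotomies between classes with disjoint traces leave one
  large class on each side, and these share \<open>i\<close> or share \<open>j\<close>, which
  becomes the third element.\<close>

lemma no_bad_pair:
  assumes F: "dispersed F" and xy: "x \<in> V" "y \<in> V" "x \<noteq> y"
    and ij: "i \<in> V - {x, y}" "j \<in> V - {x, y}" "i \<noteq> j"
    and few: "cnt F (\<lambda>A. x \<notin> A \<and> y \<notin> A) \<le> 1.3 * a"
    and bad: "cnt F (\<lambda>A. i \<notin> A \<and> j \<notin> A) < (1/3 + \<epsilon>) * real (card F)"
  shows False
proof -
  note D = dispersedD[OF F]
  let ?A = "\<lambda>s t. cnt F (\<lambda>A. x \<in> A \<and> y \<notin> A \<and> (i \<in> A) = s \<and> (j \<in> A) = t)"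
  let ?B = "\<lambda>s t. cnt F (\<lambda>A. x \<notin> A \<and> y \<in> A \<and> (i \<in> A) = s \<and> (j \<in> A) = t)"
  have triple: "cnt F \<phi> \<le> a" if "\<And>A. \<phi> A \<Longrightarrow> {u, i, j} \<subseteq> A" "u \<in> {x, y}" for u \<phi>
  proof -
    have "real (card {A \<in> F. \<phi> A}) \<le> sups (card {u, i, j})"
      using that D(1) xy ij by (intro card_superset_le) auto
    moreover have "card {u, i, j} = 3" using that(2) ij by auto
    ultimately show ?thesis unfolding cnt_def by simp
  qed
  have "cnt F (\<lambda>A. y \<notin> A) \<le> cnt F (\<lambda>A. x \<notin> A \<and> y \<notin> A) + cnt F (\<lambda>A. x \<in> A \<and> y \<notin> A)"
    by (rule cnt_le_add[OF D(3)]) blast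
  moreover have "cnt F (\<lambda>A. x \<in> A \<and> y \<notin> A) \<le> ?A False False + ?A True False + ?A False True + ?A True True"
    by (rule cnt_le_add4[OF D(3)]) blast
  moreover have "?A True True \<le> a" by (rule triple[of _ x]) auto
  ultimately have A: "(1/3 + \<epsilon>) * real (card F) \<le> ?A False False + ?A True False + ?A False True + 2.3 * a"
    using D(4)[OF xy(2)] few by linarith
  have "cnt F (\<lambda>A. x \<notin> A) \<le> cnt F (\<lambda>A. x \<notin> A \<and> y \<notin> A) + cnt F (\<lambda>A. x \<notin> A \<and> y \<in> A)"
    by (rule cnt_le_add[OF D(3)]) blast
  moreover have "cnt F (\<lambda>A. x \<notin> A \<and> y \<in> A) \<le> ?B False False + ?B True False + ?B False True + ?B True True"
    by (rule cnt_le_add4[OF D(3)]) blast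
  moreover have "?B True True \<le> a" by (rule triple[of _ y]) auto
  ultimately have B: "(1/3 + \<epsilon>) * real (card F) \<le> ?B False False + ?B True False + ?B False True + 2.3 * a"
    using D(4)[OF xy(1)] few by linarith
  have "?A False False + ?B False False \<le> cnt F (\<lambda>A. i \<notin> A \<and> j \<notin> A)"
    by (rule cnt_add_le[OF D(3)]) auto
  then have AB: "?A False False + ?B False False < (1/3 + \<epsilon>) * real (card F)" using bad by linarith
  have c1: "?A True False \<le> 1.2 * a \<or> ?B False False \<le> 5/4 * a"
    by (rule cnt_dichotomy1[OF D(1,2), of _ x i "{x,y,i,j}" _ y]) (use xy ij in auto)
  have c2: "?A False True \<le> 1.2 * a \<or> ?B False False \<le> 5/4 * a"
    by (rule cnt_dichotomy1[OF D(1,2), of _ x j "{x,y,i,j}" _ y]) (use xy ij in auto)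
  have c3: "?B True False \<le> 1.2 * a \<or> ?A False False \<le> 5/4 * a"
    by (rule cnt_dichotomy1[OF D(1,2), of _ y i "{x,y,i,j}" _ x]) (use xy ij in auto)
  have c4: "?B False True \<le> 1.2 * a \<or> ?A False False \<le> 5/4 * a"
    by (rule cnt_dichotomy1[OF D(1,2), of _ y j "{x,y,i,j}" _ x]) (use xy ij in auto)
  have c5: "?A True False \<le> 1.2 * a \<or> ?B False True \<le> 5/4 * a"
    by (rule cnt_dichotomy1[OF D(1,2), of _ x i "{x,y,i,j}" _ y]) (use xy ij in auto)
  have c6: "?A False True \<le> 1.2 * a \<or> ?B True False \<le> 5/4 * a"
    by (rule cnt_dichotomy1[OF D(1,2), of _ x j "{x,y,i,j}" _ y]) (use xy ij in auto)
  \<comment> \<open>If this class were large, both classes avoiding \<open>i\<close> and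
    \<open>j\<close> would be at least the avoidance bound minus \<open>4.7 * a\<close>; their sum
    would then contradict \<open>bad\<close>.\<close>
  have A0: "?A False False \<le> 5/4 * a"
  proof (rule ccontr)
    assume n: "\<not> ?thesis"
    then have "?B True False \<le> 1.2 * a" "?B False True \<le> 1.2 * a" using c3 c4 by auto
    then have B0: "(1/3 + \<epsilon>) * real (card F) - 4.7 * a \<le> ?B False False" using B by linarith
    then have "\<not> ?B False False \<le> 5/4 * a" using D(5) a_ge1 by linarith
    then have "?A True False \<le> 1.2 * a" "?A False True \<le> 1.2 * a" using c1 c2 by auto
    then show False using A B0 AB D(5) a_ge1 by linarith
  qed
  have B0: "?B False False \<le> 5/4 * a"
  proof (rule ccontr)
    assume n: "\<not> ?thesis"
    then have "?A True False \<le> 1.2 * a" "?A False True \<le> 1.2 * a" using c1 c2 by auto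
    then show False using A A0 D(5) a_ge1 by linarith
  qed
  have cover: "cnt F (\<lambda>A. P A \<and> Q A \<and> j \<notin> A) \<le> cnt F (\<lambda>A. P A \<and> Q A \<and> (i \<in> A) = False \<and> (j \<in> A) = False)
      + cnt F (\<lambda>A. P A \<and> Q A \<and> (i \<in> A) = True \<and> (j \<in> A) = False)"
    "cnt F (\<lambda>A. P A \<and> Q A \<and> i \<notin> A) \<le> cnt F (\<lambda>A. P A \<and> Q A \<and> (i \<in> A) = False \<and> (j \<in> A) = False)
      + cnt F (\<lambda>A. P A \<and> Q A \<and> (i \<in> A) = False \<and> (j \<in> A) = True)" for P Q
    by (rule cnt_le_add[OF D(3)]; blast)+
  show False
  \<comment> \<open>The large class on the \<open>x\<close> side decides: if it contains
    \<open>j\<close> but not \<open>i\<close>, then \<open>j\<close> is the third element, otherwise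
    \<open>i\<close> is.\<close>
  proof (cases "?A False True \<le> 1.2 * a")
    case False
    then have "?B True False \<le> 5/4 * a" using c6 by auto
    then have "\<not> ?B False True \<le> 5/4 * a" using B B0 D(5) a_ge1 by linarith
    then have "?A True False \<le> 1.2 * a" using c5 by auto
    then have "cnt F (\<lambda>A. x \<in> A \<and> y \<notin> A \<and> j \<notin> A) \<le> 3 * a" "cnt F (\<lambda>A. x \<notin> A \<and> y \<in> A \<and> j \<notin> A) \<le> 3 * a"
      using A0 B0 \<open>?B True False \<le> _\<close> a_ge1 cover(1)[of "\<lambda>A. x \<in> A" "\<lambda>A. y \<notin> A"]
        cover(1)[of "\<lambda>A. x \<notin> A" "\<lambda>A. y \<in> A"] by linarith+
    then show False using no_third_element[OF F, of x y j] xy ij few by auto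
  next
    case True
    then have "\<not> ?A True False \<le> 1.2 * a" using A A0 D(5) a_ge1 by linarith
    then have "?B False True \<le> 5/4 * a" using c5 by auto
    then have "cnt F (\<lambda>A. x \<in> A \<and> y \<notin> A \<and> i \<notin> A) \<le> 3 * a" "cnt F (\<lambda>A. x \<notin> A \<and> y \<in> A \<and> i \<notin> A) \<le> 3 * a"
      using A0 B0 True a_ge1 cover(2)[of "\<lambda>A. x \<in> A" "\<lambda>A. y \<notin> A"]
        cover(2)[of "\<lambda>A. x \<notin> A" "\<lambda>A. y \<in> A"] by linarith+
    then show False using no_third_element[OF F, of x y i] xy ij few by auto
  qed
qed

text \<open>The separate weight \<open>w'\<close> allows renumbering after the first element has
  been dropped.\<close>

lemma shifted_filter:
  assumes sh: "shifted w X F" and X': "X' \<subseteq> X"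
    and w: "\<And>i j. i \<in> X' \<Longrightarrow> j \<in> X' \<Longrightarrow> w' i < w' j \<Longrightarrow> w i < w j"
    and \<phi>: "\<And>A i j. i \<in> X' \<Longrightarrow> j \<in> X' \<Longrightarrow> \<phi> A \<Longrightarrow> \<phi> (insert i (A - {j}))"
  shows "shifted w' X' {A \<in> F. \<phi> A}"
  unfolding shifted_def
proof (intro ballI impI)
  fix A i j
  assume A: "A \<in> {A \<in> F. \<phi> A}" and ij: "i \<in> X'" "j \<in> X'" "w' i < w' j" and m: "j \<in> A" "i \<notin> A"
  have "insert i (A - {j}) \<in> F"
    using sh A m w[OF ij] subsetD[OF X' ij(1)] subsetD[OF X' ij(2)] unfolding shifted_def by simp
  then show "insert i (A - {j}) \<in> {A \<in> F. \<phi> A}" using \<phi>[OF ij(1,2)] A by simp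
qed

text \<open>A heavy pair is avoided by few sets, and this persists while only the other elements are
  shifted. The process ends with a bad pair disjoint from \<open>{x, y}\<close>, or with a shifted
  family whose first element \<open>p\<close> is the third element.\<close>

lemma no_heavy_pair:
  assumes F: "dispersed F" and xy: "x \<in> V" "y \<in> V" "x \<noteq> y"
  shows "cnt F (\<lambda>A. x \<in> A \<and> y \<in> A) \<le> 2.4 * a"
proof (rule ccontr)
  assume h: "\<not> ?thesis"
  let ?X = "V - {x, y}"
  have finX: "finite ?X" using finV by simp
  have "card ?X = card V - 2" using xy finV by (simp add: card_Diff_subset)
  then have cX: "0 < card ?X" using k_le k3 by linarith
  obtain w where w: "bij_betw w ?X {..<card ?X}"
    using ex_bij_betw_finite_nat[OF finX] by (auto simp: atLeast0LessThan)
  obtain G where G: "dispersed G" "card G = card F"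
    "\<And>\<phi>. (\<And>A B. A - ?X = B - ?X \<Longrightarrow> \<phi> A = \<phi> B) \<Longrightarrow> cnt G \<phi> = cnt F \<phi>"
    "shifted w ?X G \<or>
     (\<exists>i\<in>?X. \<exists>j\<in>?X. i \<noteq> j \<and> cnt G (\<lambda>A. i \<notin> A \<and> j \<notin> A) < (1/3 + \<epsilon>) * real (card G))"
    using exists_shifted_or_bad_pair[OF F, of ?X w] by blast
  note D = dispersedD[OF G(1)]
  have "cnt G (\<lambda>A. x \<in> A \<and> y \<in> A) = cnt F (\<lambda>A. x \<in> A \<and> y \<in> A)"
    by (rule G(3)) (use xy in blast)
  then have few: "cnt G (\<lambda>A. x \<notin> A \<and> y \<notin> A) \<le> 1.3 * a"
    using cnt_dichotomy2[OF D(1,2) xy] h by auto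
  show False
    using G(4)
  proof
    assume sh: "shifted w ?X G"
    obtain p where p: "p \<in> ?X" "w p = 0"
      using w cX unfolding bij_betw_def by (metis imageE lessThan_iff)
    have fd: "cnt G (\<lambda>A. u \<in> A \<and> v \<notin> A \<and> p \<notin> A) \<le> 5/4 * a \<or> cnt G (\<lambda>A. v \<in> A \<and> u \<notin> A) \<le> 5/4 * a"
      if "(u, v) = (x, y) \<or> (u, v) = (y, x)" for u v
    proof -
      let ?P = "{A \<in> G. u \<in> A \<and> v \<notin> A}" and ?Q = "{A \<in> G. v \<in> A \<and> u \<notin> A}"
      have "real (card {A \<in> ?P. p \<notin> A}) \<le> 5/4 * a \<or> real (card ?Q) \<le> 5/4 * a"
      proof (rule first_element_dichotomy[where u=u and v=v, OF _ w p])
        show "shifted w ?X ?P" using that by (intro shifted_filter[OF sh]) auto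
        show "cross_on ?X ?P ?Q" using D(2) that unfolding cross_on_def by fastforce
      qed (use D(1) that xy in auto)
      then show ?thesis unfolding cnt_def by (simp add: conj_ac)
    qed
    \<comment> \<open>At least \<open>16 * a\<close> sets avoid \<open>y\<close> and few of them
      avoid \<open>x\<close>, so the second alternatives of \<open>fd\<close> fail.\<close>
    have "cnt G (\<lambda>A. y \<notin> A) \<le> cnt G (\<lambda>A. x \<notin> A \<and> y \<notin> A) + cnt G (\<lambda>A. x \<in> A \<and> y \<notin> A)"
      by (rule cnt_le_add[OF D(3)]) blast
    then have "\<not> cnt G (\<lambda>A. x \<in> A \<and> y \<notin> A) \<le> 5/4 * a"
      using few D(4)[OF xy(2)] D(5) a_ge1 by linarith
    moreover have "cnt G (\<lambda>A. x \<notin> A) \<le> cnt G (\<lambda>A. x \<notin> A \<and> y \<notin> A) + cnt G (\<lambda>A. y \<in> A \<and> x \<notin> A)"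
      by (rule cnt_le_add[OF D(3)]) blast
    then have "\<not> cnt G (\<lambda>A. y \<in> A \<and> x \<notin> A) \<le> 5/4 * a"
      using few D(4)[OF xy(1)] D(5) a_ge1 by linarith
    ultimately have s: "cnt G (\<lambda>A. x \<in> A \<and> y \<notin> A \<and> p \<notin> A) \<le> 5/4 * a"
      "cnt G (\<lambda>A. y \<in> A \<and> x \<notin> A \<and> p \<notin> A) \<le> 5/4 * a"
      using fd[of x y] fd[of y x] by auto
    have e: "(\<lambda>A. y \<in> A \<and> x \<notin> A \<and> p \<notin> A) = (\<lambda>A. x \<notin> A \<and> y \<in> A \<and> p \<notin> A)" by auto
    show False
      using no_third_element[OF G(1), of x y p] xy p few s a_ge1 unfolding e by auto
  next
    assume "\<exists>i\<in>?X. \<exists>j\<in>?X. i \<noteq> j \<and> cnt G (\<lambda>A. i \<notin> A \<and> j \<notin> A) < (1/3 + \<epsilon>) * real (card G)"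
    then show False using no_bad_pair[OF G(1) xy] few by blast
  qed
qed

section \<open>Completely shifted families and bad pairs\<close>

text \<open>
  As all pair degrees are small, nearly all sets avoiding \<open>u\<close>, \<open>v\<close> contain the first element
  \<open>p\<close>, while few sets meeting \<open>u\<close>, \<open>v\<close> in one element avoid \<open>p\<close>; so too few sets avoid \<open>p\<close>.
\<close>
lemma not_shifted_off_pair:
  assumes G: "dispersed G" and uv: "u \<in> V" "v \<in> V" "u \<noteq> v"
    and w: "bij_betw w (V - {u, v}) {..<card (V - {u, v})}"
  shows "\<not> shifted w (V - {u, v}) G"
proof
  let ?X = "V - {u, v}"
  assume sh: "shifted w ?X G"
  note D = dispersedD[OF G]
  note light = no_heavy_pair[OF G]
  have finX: "finite ?X" using finV by simp
  have "card ?X = card V - 2" using uv finV by (simp add: card_Diff_subset)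
  then have cX: "3 < card ?X" using k_le k3 by linarith
  have inj: "x = y" if "x \<in> ?X" "y \<in> ?X" "w x = w y" for x y
    using that w unfolding bij_betw_def inj_on_def by blast
  have "m \<in> w ` ?X" if "m < card ?X" for m using w that unfolding bij_betw_def by auto
  then have "0 \<in> w ` ?X" "1 \<in> w ` ?X" "2 \<in> w ` ?X" using cX by auto
  then obtain p q r where p: "p \<in> ?X" "w p = 0" and q: "q \<in> ?X" "w q = 1" and r: "r \<in> ?X" "w r = 2"
    by (elim imageE) metis
  have seg3: "seg w ?X 3 \<subseteq> {p, q, r}"
  proof
    fix x assume x: "x \<in> seg w ?X 3"
    then have "w x = 0 \<or> w x = 1 \<or> w x = 2" unfolding seg_def by auto
    moreover have "x \<in> ?X" using x unfolding seg_def by auto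
    ultimately show "x \<in> {p, q, r}" using inj[of x p] inj[of x q] inj[of x r] p q r by auto
  qed
  have seg1: "seg w ?X 1 \<subseteq> {p}"
  proof
    fix x assume "x \<in> seg w ?X 1"
    then show "x \<in> {p}" using inj[of x p] p unfolding seg_def by auto
  qed
  let ?C = "{A \<in> G. u \<notin> A \<and> v \<notin> A}"
  let ?R = "{A \<in> ?C. p \<notin> A \<and> \<not> (q \<in> A \<and> r \<in> A)}"
  have shC: "shifted w ?X ?C" by (intro shifted_filter[OF sh]) auto
  have crC: "cross_on ?X ?C ?C" using D(2) unfolding cross_on_def by fastforce
  have "real (card ?R) \<le> walk_sum 4 3 k * sups (card ({} :: 'a set) + 3)"
  proof (rule card_walk_le[where S="\<lambda>j. seg w ?X (5 + 2 * j) - {p}"])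
    fix A assume A: "A \<in> ?R"
    then have "A \<in> ?C" by auto
    \<comment> \<open>The walk lemma for \<open>A\<close> with itself: some initial segment is more
      than half filled by \<open>A\<close>.\<close>
    from shifted_cross_walk[OF finX w shC crC this this]
    obtain i where i: "i < card (A \<inter> seg w ?X i) + card (A \<inter> seg w ?X i)" by auto
    define j where "j = i div 2"
    have "card (A \<inter> seg w ?X i) \<le> card (A \<inter> seg w ?X (1 + 2 * j))"
      using finX by (intro card_mono) (auto simp: seg_def j_def)
    then have j: "1 + j \<le> card (A \<inter> seg w ?X (1 + 2 * j))" using i unfolding j_def by linarith
    have "j \<noteq> 0"
    proof
      assume "j = 0"
      moreover have "A \<inter> seg w ?X 1 = {}" using seg1 A by auto
      ultimately show False using j by simp
    qed
    moreover have "j \<noteq> 1"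
    proof
      \<comment> \<open>Two of the first three elements would have to be \<open>q\<close> and
        \<open>r\<close>, as \<open>p\<close> is missing; \<open>?R\<close> excludes this. So
        \<open>j\<close> is at least 2, leaving \<open>3 + l\<close> of \<open>4 + 2 * l\<close>
        elements.\<close>
      assume j1: "j = 1"
      have sub: "A \<inter> seg w ?X 3 \<subseteq> A \<inter> {q, r}" using seg3 A by auto
      have "\<not> {q, r} \<subseteq> A" using A by auto
      then have "A \<inter> {q, r} \<subseteq> {q} \<or> A \<inter> {q, r} \<subseteq> {r}" by auto
      then have "card (A \<inter> {q, r}) \<le> 1" using card_mono[of "{q}"] card_mono[of "{r}"] by fastforce
      then have "card (A \<inter> seg w ?X 3) \<le> 1" using card_mono[OF _ sub] by auto
      moreover have "1 + 1 \<le> card (A \<inter> seg w ?X 3)"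
        using j j1 by (simp add: numeral_3_eq_3)
      ultimately show False by linarith
    qed
    ultimately have "j = (j - 2) + 2" by linarith
    then obtain l where l: "j = l + 2" by blast
    have "1 + 2 * j = 5 + 2 * l" using l by simp
    then have "A \<inter> (seg w ?X (5 + 2 * l) - {p}) = A \<inter> seg w ?X (1 + 2 * j)"
      using A by auto
    then show "\<exists>j. 3 + j \<le> card (A \<inter> (seg w ?X (5 + 2 * j) - {p}))"
      using j l by (intro exI[of _ l]) simp
  next
    fix j
    have "p \<in> seg w ?X (5 + 2 * j)" "finite (seg w ?X (5 + 2 * j))"
      using p finX unfolding seg_def by auto
    then show "card (seg w ?X (5 + 2 * j) - {p}) \<le> 4 + 2 * j"
      using card_seg(1)[OF w, of "5 + 2 * j"] by simp
  qed (use D(1) in \<open>auto simp: seg_def\<close>)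
  also have "\<dots> \<le> 4.8 * a" using a_mult_mono[OF walk_sum_numeric(7)[OF k3]] by simp
  finally have R: "cnt G (\<lambda>A. u \<notin> A \<and> v \<notin> A \<and> p \<notin> A \<and> \<not> (q \<in> A \<and> r \<in> A)) \<le> 4.8 * a"
    unfolding cnt_def by (simp add: conj_ac)
  have "cnt G (\<lambda>A. u \<notin> A \<and> v \<notin> A \<and> p \<notin> A) \<le> cnt G (\<lambda>A. q \<in> A \<and> r \<in> A)
    + cnt G (\<lambda>A. u \<notin> A \<and> v \<notin> A \<and> p \<notin> A \<and> \<not> (q \<in> A \<and> r \<in> A))"
    by (rule cnt_le_add[OF D(3)]) blast
  moreover have "q \<noteq> r" using q r by auto
  ultimately have C: "cnt G (\<lambda>A. u \<notin> A \<and> v \<notin> A \<and> p \<notin> A) \<le> 7.2 * a"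
    using R light[of q r] q r by auto
  \<comment> \<open>Renumbers the elements after \<open>p\<close>, so that \<open>q\<close> comes
    first.\<close>
  let ?w = "\<lambda>x. w x - 1"
  have w': "bij_betw ?w (?X - {p}) {..<card (?X - {p})}"
  proof -
    have pos: "0 < w x" if "x \<in> ?X - {p}" for x using that inj[of x p] p by auto
    have "inj_on ?w (?X - {p})"
    proof (rule inj_onI)
      fix x y assume "x \<in> ?X - {p}" "y \<in> ?X - {p}" "w x - 1 = w y - 1"
      then show "x = y" using pos[of x] pos[of y] inj[of x y] by auto
    qed
    moreover have "?w ` (?X - {p}) = {..<card (?X - {p})}"
    proof (rule card_subset_eq)
      show "?w ` (?X - {p}) \<subseteq> {..<card (?X - {p})}"
      proof
        fix m assume "m \<in> ?w ` (?X - {p})"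
        then obtain x where x: "x \<in> ?X - {p}" "m = w x - 1" by auto
        moreover have "w x < card ?X" using w x unfolding bij_betw_def by auto
        ultimately show "m \<in> {..<card (?X - {p})}" using pos[of x] p finX by simp
      qed
      show "card (?w ` (?X - {p})) = card {..<card (?X - {p})}"
        using calculation by (simp add: card_image)
    qed simp
    ultimately show ?thesis unfolding bij_betw_def by blast
  qed
  have "p \<noteq> q" using p q by auto
  have q': "q \<in> ?X - {p}" "?w q = 0" using p q by auto
  have small: "cnt G (\<lambda>A. s \<in> A \<and> t \<notin> A \<and> p \<notin> A) \<le> 5/4 * a"
    if st: "(s, t) = (u, v) \<or> (s, t) = (v, u)" for s t
  proof (rule ccontr)
    assume big: "\<not> ?thesis"
    have stX: "?X = V - {s, t}" "s \<in> V" "t \<in> V" "s \<noteq> t" using st uv by auto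
    let ?P = "{A \<in> G. s \<in> A \<and> t \<notin> A}" and ?Q = "{A \<in> G. t \<in> A \<and> s \<notin> A}"
    have "real (card {A \<in> ?P. p \<notin> A}) \<le> 5/4 * a \<or> real (card ?Q) \<le> 5/4 * a"
    proof (rule first_element_dichotomy[where u=s and v=t, OF _ w p])
      show "shifted w ?X ?P" using st by (intro shifted_filter[OF sh]) auto
      show "cross_on ?X ?P ?Q" using D(2) st unfolding cross_on_def by fastforce
    qed (use D(1) stX in auto)
    then have Q: "cnt G (\<lambda>A. t \<in> A \<and> s \<notin> A) \<le> 5/4 * a"
      using big unfolding cnt_def by (simp add: conj_ac)
    \<comment> \<open>A second use of the dichotomy, with \<open>p\<close> and \<open>s\<close> as
      the prescribed elements and \<open>q\<close> first: \<open>?Q'\<close> being large, few sets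
      contain \<open>p\<close> but avoid \<open>s\<close>, \<open>t\<close> and \<open>q\<close>.
      Then at most \<open>12.1 * a\<close> sets avoid \<open>s\<close>, fewer than the required
      \<open>16 * a\<close>.\<close>
    let ?P' = "{A \<in> G. p \<in> A \<and> s \<notin> A \<and> t \<notin> A}" and ?Q' = "{A \<in> G. s \<in> A \<and> t \<notin> A \<and> p \<notin> A}"
    have "real (card {A \<in> ?P'. q \<notin> A}) \<le> 5/4 * a \<or> real (card ?Q') \<le> 5/4 * a"
    proof (rule first_element_dichotomy[where u=p and v=s, OF _ w' q'])
      show "shifted ?w (?X - {p}) ?P'"
        using st p by (intro shifted_filter[OF sh]) auto
      show "cross_on (?X - {p}) ?P' ?Q'" using D(2) stX(1) unfolding cross_on_def by fastforce
    qed (use D(1) stX p in auto)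
    then have P: "cnt G (\<lambda>A. p \<in> A \<and> s \<notin> A \<and> t \<notin> A \<and> q \<notin> A) \<le> 5/4 * a"
      using big unfolding cnt_def by (simp add: conj_ac)
    have "cnt G (\<lambda>A. s \<notin> A) \<le> cnt G (\<lambda>A. t \<in> A \<and> s \<notin> A)
      + cnt G (\<lambda>A. p \<in> A \<and> s \<notin> A \<and> t \<notin> A \<and> q \<notin> A) + cnt G (\<lambda>A. p \<in> A \<and> q \<in> A)
      + cnt G (\<lambda>A. u \<notin> A \<and> v \<notin> A \<and> p \<notin> A)"
      using st by (intro cnt_le_add4[OF D(3)]) auto
    moreover have "cnt G (\<lambda>A. p \<in> A \<and> q \<in> A) \<le> 2.4 * a" using light[of p q] p q \<open>p \<noteq> q\<close> by auto
    ultimately show False using P Q C D(4)[OF stX(2)] D(5) a_ge1 by linarith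
  qed
  \<comment> \<open>The four parts add up to \<open>2.4 + 1.25 + 1.25 + 7.2 = 12.1\<close> times
    \<open>a\<close>, again below 16.\<close>
  have "cnt G (\<lambda>A. p \<notin> A) \<le> cnt G (\<lambda>A. u \<in> A \<and> v \<in> A)
      + cnt G (\<lambda>A. u \<in> A \<and> v \<notin> A \<and> p \<notin> A) + cnt G (\<lambda>A. v \<in> A \<and> u \<notin> A \<and> p \<notin> A)
      + cnt G (\<lambda>A. u \<notin> A \<and> v \<notin> A \<and> p \<notin> A)"
    by (intro cnt_le_add4[OF D(3)]) auto
  moreover have "cnt G (\<lambda>A. u \<in> A \<and> v \<notin> A \<and> p \<notin> A) \<le> 5/4 * a" by (rule small) simp
  moreover have "cnt G (\<lambda>A. v \<in> A \<and> u \<notin> A \<and> p \<notin> A) \<le> 5/4 * a" by (rule small) simp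
  moreover have "p \<in> V" using p by auto
  ultimately show False
    using light[OF uv] C D(4)[of p] D(5) a_ge1 by linarith
qed

text \<open>Apart from at most \<open>2 * 9/24\<close> of the family, every set contains one element
  of each pair, hence one of four light pairs. This bounds \<open>card F / 4\<close> by
  \<open>9.6 * a\<close>, less than a quarter of \<open>48 * a\<close>.\<close>

lemma no_two_disjoint_bad_pairs:
  assumes F: "dispersed F" and ij: "i \<in> V" "j \<in> V" "i' \<in> V - {i, j}" "j' \<in> V - {i, j}"
    and bad: "cnt F (\<lambda>A. i \<notin> A \<and> j \<notin> A) < (1/3 + \<epsilon>) * real (card F)"
      "cnt F (\<lambda>A. i' \<notin> A \<and> j' \<notin> A) < (1/3 + \<epsilon>) * real (card F)"
  shows False
proof -
  note D = dispersedD[OF F]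
  have "cnt F (\<lambda>A. True) \<le> cnt F (\<lambda>A. i \<notin> A \<and> j \<notin> A) + cnt F (\<lambda>A. i' \<notin> A \<and> j' \<notin> A)
     + cnt F (\<lambda>A. (i \<in> A \<or> j \<in> A) \<and> (i' \<in> A \<or> j' \<in> A)) + cnt F (\<lambda>A. False)"
    by (rule cnt_le_add4[OF D(3)]) blast
  moreover have "cnt F (\<lambda>A. (i \<in> A \<or> j \<in> A) \<and> (i' \<in> A \<or> j' \<in> A)) \<le> cnt F (\<lambda>A. i \<in> A \<and> i' \<in> A)
    + cnt F (\<lambda>A. i \<in> A \<and> j' \<in> A) + cnt F (\<lambda>A. j \<in> A \<and> i' \<in> A) + cnt F (\<lambda>A. j \<in> A \<and> j' \<in> A)"
    by (rule cnt_le_add4[OF D(3)]) blast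
  moreover have "cnt F (\<lambda>A. False) = 0" "cnt F (\<lambda>A. True) = real (card F)" unfolding cnt_def by auto
  moreover have "cnt F (\<lambda>A. i \<in> A \<and> i' \<in> A) \<le> 2.4 * a" "cnt F (\<lambda>A. i \<in> A \<and> j' \<in> A) \<le> 2.4 * a"
    "cnt F (\<lambda>A. j \<in> A \<and> i' \<in> A) \<le> 2.4 * a" "cnt F (\<lambda>A. j \<in> A \<and> j' \<in> A) \<le> 2.4 * a"
    using ij by (intro no_heavy_pair[OF F]; auto)+
  moreover have "(1/3 + \<epsilon>) * real (card F) \<le> (9/24) * real (card F)"
    using eps24 by (intro mult_right_mono) auto
  ultimately show False using bad D(6) a_ge1 by linarith
qed

text \<open>The bad pair is frozen while everything else is shifted. It stays bad, so the process
  ends either completely shifted off it or with a second bad pair disjoint from it.\<close>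

lemma no_single_bad_pair:
  assumes F: "dispersed F" and ij: "i \<in> V" "j \<in> V" "i \<noteq> j"
    and bad: "cnt F (\<lambda>A. i \<notin> A \<and> j \<notin> A) < (1/3 + \<epsilon>) * real (card F)"
  shows False
proof -
  let ?X = "V - {i, j}"
  obtain w where w: "bij_betw w ?X {..<card ?X}"
    using ex_bij_betw_finite_nat[of ?X] finV by (auto simp: atLeast0LessThan)
  obtain G where G: "dispersed G" "card G = card F"
    "\<And>\<phi>. (\<And>A B. A - ?X = B - ?X \<Longrightarrow> \<phi> A = \<phi> B) \<Longrightarrow> cnt G \<phi> = cnt F \<phi>"
    "shifted w ?X G \<or>
     (\<exists>i\<in>?X. \<exists>j\<in>?X. i \<noteq> j \<and> cnt G (\<lambda>A. i \<notin> A \<and> j \<notin> A) < (1/3 + \<epsilon>) * real (card G))"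
    using exists_shifted_or_bad_pair[OF F, of ?X w] by blast
  have "cnt G (\<lambda>A. i \<notin> A \<and> j \<notin> A) = cnt F (\<lambda>A. i \<notin> A \<and> j \<notin> A)"
    by (rule G(3)) (use ij in blast)
  then have "cnt G (\<lambda>A. i \<notin> A \<and> j \<notin> A) < (1/3 + \<epsilon>) * real (card G)" using bad G(2) by simp
  then show False
    using G(4) not_shifted_off_pair[OF G(1) ij w] no_two_disjoint_bad_pairs[OF G(1) ij(1,2)] by blast
qed

lemma not_dispersed: "\<not> dispersed F"
proof
  assume F: "dispersed F"
  obtain w where w: "bij_betw w V {..<card V}"
    using ex_bij_betw_finite_nat[OF finV] by (auto simp: atLeast0LessThan)
  obtain G where G: "dispersed G" "shifted w V G \<or>
     (\<exists>i\<in>V. \<exists>j\<in>V. i \<noteq> j \<and> cnt G (\<lambda>A. i \<notin> A \<and> j \<notin> A) < (1/3 + \<epsilon>) * real (card G))"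
    by (rule exists_shifted_or_bad_pair[OF F order_refl, of w]) (erule that)
  then have sh: "shifted w V G" using no_single_bad_pair by blast
  have c: "2 < card V" using k_le k3 by linarith
  \<comment> \<open>Removing the two last elements leaves a set that \<open>w\<close> still numbers
    consecutively from 0.\<close>
  then have "card V - 1 \<in> w ` V" "card V - 2 \<in> w ` V" using w unfolding bij_betw_def by auto
  then obtain u v where uv: "u \<in> V" "w u = card V - 1" "v \<in> V" "w v = card V - 2"
    by (metis imageE)
  have ne: "u \<noteq> v" using uv c by auto
  have cX: "card (V - {u, v}) = card V - 2" using uv ne finV by (simp add: card_Diff_subset)
  have inj: "inj_on w V" "w ` V = {..<card V}" using w unfolding bij_betw_def by auto
  have "w ` (V - {u, v}) = w ` V - w ` {u, v}"
    using uv inj(1) by (intro inj_on_image_set_diff) auto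
  also have "\<dots> = {..<card (V - {u, v})}" unfolding cX using uv inj(2) c by auto
  finally have "bij_betw w (V - {u, v}) {..<card (V - {u, v})}"
    using inj(1) unfolding bij_betw_def by (auto intro: inj_on_subset)
  moreover have "shifted w (V - {u, v}) G" using sh unfolding shifted_def by blast
  ultimately show False using not_shifted_off_pair[OF G(1) uv(1,3) ne] by blast
qed

end

section \<open>Sets of size at most 2, and the passage from \<open>rho\<close> to avoidance
  counts\<close>

lemma card_link: "card (link F x) = card {A \<in> F. x \<in> A}"
proof -
  have "link F x = (\<lambda>A. A - {x}) ` {A \<in> F. x \<in> A}" unfolding link_def by auto
  moreover have "inj_on (\<lambda>A. A - {x}) {A \<in> F. x \<in> A}" by (rule inj_onI) blast
  ultimately show ?thesis by (simp add: card_image)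
qed

lemma cnt_avoid_ge_of_rho_le:
  assumes "finite F" "F \<noteq> {}" "rho n F \<le> 2/3 - \<epsilon>" "x \<in> {1..n}"
  shows "(1/3 + \<epsilon>) * real (card F) \<le> cnt F (\<lambda>A. x \<notin> A)"
proof -
  have pos: "0 < real (card F)" using assms(1,2) by (simp add: card_gt_0_iff)
  have "real (card (link F x)) / real (card F) \<le> rho n F"
    unfolding rho_def using assms(4) by (intro Max_ge) auto
  then have "real (card (link F x)) / real (card F) \<le> 2/3 - \<epsilon>" using assms(3) by linarith
  then have "cnt F (\<lambda>A. x \<in> A) \<le> (2/3 - \<epsilon>) * real (card F)"
    unfolding cnt_def card_link using pos by (simp add: pos_divide_le_eq)
  moreover have "real (card F) = cnt F (\<lambda>A. x \<in> A) + cnt F (\<lambda>A. x \<notin> A)"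
    using cnt_split[OF assms(1), of "\<lambda>_. True" "\<lambda>A. x \<in> A"] unfolding cnt_def by simp
  ultimately show ?thesis by (simp add: algebra_simps)
qed

text \<open>If no element lies in all sets, then k = 2 and \<open>F\<close> contains a triangle;
  every member then contains two of its vertices, so the three avoidance counts sum to at most
  \<open>card F\<close>.\<close>

lemma exists_heavy_element_small:
  assumes fin: "finite F" and ne: "F \<noteq> {}" and int: "intersecting F" and \<epsilon>: "0 < \<epsilon>"
    and sub: "F \<subseteq> ksets V k" and k: "k = 1 \<or> k = 2"
  shows "\<exists>x\<in>V. cnt F (\<lambda>A. x \<notin> A) < (1/3 + \<epsilon>) * real (card F)"
proof (rule ccontr)
  assume "\<not> ?thesis"
  then have avoid: "(1/3 + \<epsilon>) * real (card F) \<le> cnt F (\<lambda>A. x \<notin> A)" if "x \<in> V" for x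
    using that by (meson not_le)
  have pos: "0 < \<epsilon> * real (card F)" using fin ne \<epsilon> by (simp add: card_gt_0_iff)
  have ex: "\<exists>A\<in>F. x \<notin> A" if x: "x \<in> V" for x
  proof (rule ccontr)
    assume "\<not> ?thesis"
    then have "{A \<in> F. x \<notin> A} = {}" by auto
    then have "cnt F (\<lambda>A. x \<notin> A) = 0" unfolding cnt_def by (simp only: card.empty of_nat_0)
    then show False using avoid[OF x] pos by (simp add: algebra_simps)
  qed
  have meet: "A \<inter> B \<noteq> {}" if "A \<in> F" "B \<in> F" for A B using int that unfolding intersecting_def by blast
  have inV: "A \<subseteq> V" "card A = k" if "A \<in> F" for A using sub that unfolding ksets_def by auto
  obtain A where A: "A \<in> F" using ne by auto
  show False
  proof (cases "k = 1")
    case True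
    then obtain x where x: "A = {x}" using inV(2)[OF A] by (auto simp: card_1_singleton_iff)
    then obtain B where "B \<in> F" "x \<notin> B" using ex[of x] inV(1)[OF A] by auto
    then show False using meet[OF A] x by auto
  next
    case False
    then have k2: "k = 2" using k by simp
    obtain x y where xy: "A = {x, y}" "x \<noteq> y" using inV(2)[OF A] k2 by (auto simp: card_2_iff)
    have V: "x \<in> V" "y \<in> V" using inV(1)[OF A] xy by auto
    obtain B where B: "B \<in> F" "x \<notin> B" using ex[OF V(1)] by auto
    then have "y \<in> B" using meet[OF A B(1)] xy by auto
    obtain c d where "B = {c, d}" "c \<noteq> d" using inV(2)[OF B(1)] k2 by (auto simp: card_2_iff)
    with \<open>y \<in> B\<close> have "B = {y, if y = c then d else c}" "y \<noteq> (if y = c then d else c)" by auto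
    then obtain z where z: "B = {y, z}" "y \<noteq> z" by blast
    obtain C where C: "C \<in> F" "y \<notin> C" using ex[OF V(2)] by auto
    then have "x \<in> C" "z \<in> C" using meet[OF A C(1)] meet[OF B(1) C(1)] xy z by auto
    moreover have "x \<noteq> z" using B z by auto
    ultimately have Cxz: "C = {x, z}" using inV(2)[OF C(1)] k2 by (auto simp: card_2_iff)
    have "z \<in> V" using inV(1)[OF B(1)] z by auto
    \<comment> \<open>A set missing two vertices would miss the triangle edge joining them.\<close>
    have "cnt F (\<lambda>A. x \<notin> A \<and> y \<notin> A) = 0" "cnt F (\<lambda>A. x \<notin> A \<and> z \<notin> A) = 0"
      "cnt F (\<lambda>A. y \<notin> A \<and> z \<notin> A) = 0"
      unfolding cnt_def of_nat_eq_0_iff card_eq_0_iff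
      using meet[OF A] meet[OF B(1)] meet[OF C(1)] xy z Cxz by auto
    then show False
      using cnt_avoid_three_le[OF fin, of x y z] avoid[OF V(1)] avoid[OF V(2)] avoid[OF \<open>z \<in> V\<close>] pos
      by (simp add: algebra_simps)
  qed
qed

theorem mainTheorem3:
  fixes \<epsilon> :: real and n k :: nat and F :: "nat set set"
  assumes "0 < \<epsilon>" and "\<epsilon> \<le> 1/24"
    and "0 < n" and "0 < k"
    and "real n \<ge> real k / \<epsilon>"
    and "F \<subseteq> {A. A \<subseteq> {1..n} \<and> card A = k}"
    and "F \<noteq> {}"
    and "intersecting F"
    and "card F \<ge> 48 * binom3 n k"
  shows "rho n F > 2/3 - \<epsilon>"
proof (rule ccontr)
  assume "\<not> ?thesis"
  then have rho: "rho n F \<le> 2/3 - \<epsilon>" by simp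
  have sub: "F \<subseteq> ksets {1..n} k" using assms(6) unfolding ksets_def .
  have fin: "finite F" using sub finite_ksets[of "{1..n}" k] by (auto intro: finite_subset)
  note avoid = cnt_avoid_ge_of_rho_le[OF fin assms(7) rho]
  show False
  \<comment> \<open>Below 3 no k-set contains three points and \<open>binom3\<close> is 0, so those
    sizes are settled by direct analysis.\<close>
  proof (cases "3 \<le> k")
    case True
    interpret uniform_sets "{1..n}" k \<epsilon>
      using True assms(1,2,5) by unfold_locales (simp_all add: pos_divide_le_eq mult.commute)
    have "A \<inter> B \<inter> {1..n} \<noteq> {}" if "A \<in> F" "B \<in> F" for A B
    proof -
      have "A \<inter> B \<noteq> {}" using that assms(8) unfolding intersecting_def by blast
      moreover have "A \<subseteq> {1..n}" using that assms(6) by auto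
      ultimately show ?thesis by blast
    qed
    moreover have "48 * sups 3 \<le> real (card F)"
    proof -
      have "sups 3 = real (binom3 n k)" using True unfolding sups_def binom3_def by simp
      moreover have "real (48 * binom3 n k) \<le> real (card F)" using assms(9) by (simp only: of_nat_le_iff)
      ultimately show ?thesis by simp
    qed
    ultimately have "dispersed F"
      using sub avoid unfolding dispersed_def cross_on_def by blast
    then show False using not_dispersed by blast
  next
    case False
    then have "k = 1 \<or> k = 2" using assms(4) by auto
    from exists_heavy_element_small[OF fin assms(7,8,1) sub this]
    obtain x where "x \<in> {1..n}" "cnt F (\<lambda>A. x \<notin> A) < (1/3 + \<epsilon>) * real (card F)" by blast
    then show False using avoid[of x] by linarith
  qed
qed

end
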